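(* Over $\mathrm{RCA}_0$, the following statement (the Valuation Extension Lemma for $\mathbf{LTL}$) implies $\mathrm{ACA}_0$: for each $\mathbf{LTL}$-frame $F=(S,R)$ and each $v:S\times\mathrm{Prop}\to\{0,1\}$, there exists an $\mathbf{LTL}$-valuation $V$ on $(S,R)$ such that $V$ is an extension of $v$.
   Context: Setting: second-order arithmetic. $\mathrm{RCA}_0$ consists of Robinson arithmetic, $\Sigma^0_1$-induction and $\Delta^0_1$-comprehension; $\mathrm{ACA}_0$ adds arithmetical comprehension. $\mathrm{Prop}$ is an infinite set of propositional variables. $\mathrm{Fml}_{\mathbf{LTL}}$ is the set of formulas built from $\mathrm{Prop}\cup\{\bot\}$ by $\varphi\to\psi$, $\mathsf{X}\varphi$, $\varphi\,\mathsf{U}\,\psi$, coded as natural numbers. An $\mathbf{LTL}$-frame is a pair $(S,R)$ where $S=\{s_i\}_{i\in\mathbb{N}}$ is a set given with an enumeration $i\mapsto s_i$ by pairwise distinct elements, $R$ is a binary relation on $S$, and $S$ is an infinite path by $R$: $\forall i,j(i<j\to s_iRs_j)$. An $\mathbf{LTL}$-valuation on $(S,R)$ is a function (a set in the sense of second-order arithmetic) $V:S\times\mathrm{Fml}_{\mathbf{LTL}}\to\{0,1\}$ such that for all $i$, $\varphi$, $\psi$: $V(s_i,\bot)=0$; $V(s_i,\varphi\to\psi)=1-V(s_i,\varphi)(1-V(s_i,\psi))$; $V(s_i,\mathsf{X}\varphi)=1\iff V(s_{i+1},\varphi)=1$; $V(s_i,\varphi\,\mathsf{U}\,\psi)=1\iff\exists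 n\ge i\bigl(\forall j(i\le j<n\to V(s_j,\varphi)=1)\land V(s_n,\psi)=1\bigr)$. *)

theory Defs
  imports Main
begin

section \<open>The language of second-order arithmetic\<close>

text \<open>
  Two-sorted first-order syntax with de Bruijn indices. Number variables and set variables have
  separate index spaces: \<open>AllN\<close> binds number variable 0 and leaves the set indices alone, \<open>AllS\<close>
  binds set variable 0 and leaves the number indices alone. There is no primitive equality between
  sets.
\<close>

datatype tm =
    Var nat
  | Zero
  | Succ tm
  | Add tm tm (infixl "\<^bold>+" 65)
  | Mul tm tm (infixl "\<^bold>*" 70)

datatype fm =
    Fls
  | Eq tm tm (infix "\<^bold>=" 50)
  | Less tm tm (infix "\<^bold><" 50)
  | Mem tm nat (infix "\<^bold>\<in>" 50)
  | Imp fm fm (infixr "\<^bold>\<longrightarrow>" 25)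
  | AllN fm
  | AllS fm

definition Neg :: "fm \<Rightarrow> fm" ("\<^bold>\<not> _" [40] 40) where
  "(\<^bold>\<not> A) = (A \<^bold>\<longrightarrow> Fls)"

definition And :: "fm \<Rightarrow> fm \<Rightarrow> fm" (infixr "\<^bold>\<and>" 35) where
  "(A \<^bold>\<and> B) = (\<^bold>\<not> (A \<^bold>\<longrightarrow> \<^bold>\<not> B))"

definition Iff :: "fm \<Rightarrow> fm \<Rightarrow> fm" (infix "\<^bold>\<longleftrightarrow>" 24) where
  "(A \<^bold>\<longleftrightarrow> B) = ((A \<^bold>\<longrightarrow> B) \<^bold>\<and> (B \<^bold>\<longrightarrow> A))"

definition ExN :: "fm \<Rightarrow> fm" where
  "ExN A = (\<^bold>\<not> AllN (\<^bold>\<not> A))"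

definition ExS :: "fm \<Rightarrow> fm" where
  "ExS A = (\<^bold>\<not> AllS (\<^bold>\<not> A))"

definition LessEq :: "tm \<Rightarrow> tm \<Rightarrow> fm" (infix "\<^bold>\<le>" 50) where
  "(s \<^bold>\<le> t) = (s \<^bold>< Succ t)"

primrec num :: "nat \<Rightarrow> tm" where
  "num 0 = Zero"
| "num (Suc n) = Succ (num n)"

section \<open>Substitution\<close>

primrec tsub :: "(nat \<Rightarrow> tm) \<Rightarrow> tm \<Rightarrow> tm" where
  "tsub \<sigma> (Var n) = \<sigma> n"
| "tsub \<sigma> Zero = Zero"
| "tsub \<sigma> (Succ t) = Succ (tsub \<sigma> t)"
| "tsub \<sigma> (s \<^bold>+ t) = tsub \<sigma> s \<^bold>+ tsub \<sigma> t"
| "tsub \<sigma> (s \<^bold>* t) = tsub \<sigma> s \<^bold>* tsub \<sigma> t"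

definition tlift :: "tm \<Rightarrow> tm" where
  "tlift = tsub (\<lambda>n. Var (Suc n))"

definition upN :: "(nat \<Rightarrow> tm) \<Rightarrow> nat \<Rightarrow> tm" where
  "upN \<sigma> = case_nat (Var 0) (\<lambda>n. tlift (\<sigma> n))"

definition upS :: "(nat \<Rightarrow> nat) \<Rightarrow> nat \<Rightarrow> nat" where
  "upS \<tau> = case_nat 0 (\<lambda>n. Suc (\<tau> n))"

text \<open>
  Simultaneous capture-avoiding substitution of terms for number variables and of set variables
  for set variables.
\<close>

primrec sub :: "(nat \<Rightarrow> tm) \<Rightarrow> (nat \<Rightarrow> nat) \<Rightarrow> fm \<Rightarrow> fm" where
  "sub \<sigma> \<tau> Fls = Fls"
| "sub \<sigma> \<tau> (s \<^bold>= t) = (tsub \<sigma> s \<^bold>= tsub \<sigma> t)"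
| "sub \<sigma> \<tau> (s \<^bold>< t) = (tsub \<sigma> s \<^bold>< tsub \<sigma> t)"
| "sub \<sigma> \<tau> (t \<^bold>\<in> X) = (tsub \<sigma> t \<^bold>\<in> \<tau> X)"
| "sub \<sigma> \<tau> (A \<^bold>\<longrightarrow> B) = (sub \<sigma> \<tau> A \<^bold>\<longrightarrow> sub \<sigma> \<tau> B)"
| "sub \<sigma> \<tau> (AllN A) = AllN (sub (upN \<sigma>) \<tau> A)"
| "sub \<sigma> \<tau> (AllS A) = AllS (sub \<sigma> (upS \<tau>) A)"

definition liftN :: "fm \<Rightarrow> fm" where
  "liftN = sub (\<lambda>n. Var (Suc n)) id"

definition liftS :: "fm \<Rightarrow> fm" where
  "liftS = sub Var Suc"

definition instN :: "fm \<Rightarrow> tm \<Rightarrow> fm" where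
  "instN A t = sub (case_nat t Var) id A"

definition instS :: "fm \<Rightarrow> nat \<Rightarrow> fm" where
  "instS A X = sub Var (case_nat X id) A"

section \<open>Provability\<close>

text \<open>
  Classical natural deduction with equality on numbers. \<open>T\<close> is the set of non-logical axioms,
  \<open>\<Gamma>\<close> the list of open assumptions. Free variables of an axiom are parameters, so that an axiom
  stands for its universal closure; accordingly the eigenvariable conditions, which are expressed
  by lifting, concern \<open>\<Gamma>\<close> only.
\<close>

inductive deriv :: "fm set \<Rightarrow> fm list \<Rightarrow> fm \<Rightarrow> bool" for T where
  ax: "A \<in> T \<Longrightarrow> deriv T \<Gamma> A"
| asm: "A \<in> set \<Gamma> \<Longrightarrow> deriv T \<Gamma> A"
| impI: "deriv T (A # \<Gamma>) B \<Longrightarrow> deriv T \<Gamma> (A \<^bold>\<longrightarrow> B)"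
| impE: "deriv T \<Gamma> (A \<^bold>\<longrightarrow> B) \<Longrightarrow> deriv T \<Gamma> A \<Longrightarrow> deriv T \<Gamma> B"
| raa: "deriv T ((\<^bold>\<not> A) # \<Gamma>) Fls \<Longrightarrow> deriv T \<Gamma> A"
| allNI: "deriv T (map liftN \<Gamma>) A \<Longrightarrow> deriv T \<Gamma> (AllN A)"
| allNE: "deriv T \<Gamma> (AllN A) \<Longrightarrow> deriv T \<Gamma> (instN A t)"
| allSI: "deriv T (map liftS \<Gamma>) A \<Longrightarrow> deriv T \<Gamma> (AllS A)"
| allSE: "deriv T \<Gamma> (AllS A) \<Longrightarrow> deriv T \<Gamma> (instS A X)"
| eqI: "deriv T \<Gamma> (t \<^bold>= t)"
| eqE: "deriv T \<Gamma> (s \<^bold>= t) \<Longrightarrow> deriv T \<Gamma> (instN A s) \<Longrightarrow> deriv T \<Gamma> (instN A t)"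

definition provable :: "fm set \<Rightarrow> fm \<Rightarrow> bool" (infix "\<^bold>\<turnstile>" 30) where
  "T \<^bold>\<turnstile> A \<longleftrightarrow> deriv T [] A"

section \<open>The systems RCA0 and ACA0\<close>

text \<open>In the bounded quantifier \<open>\<forall>x < t\<close> the term \<open>t\<close> does not contain \<open>x\<close>, hence \<open>tlift\<close>.\<close>

inductive Delta00 :: "fm \<Rightarrow> bool" where
  "Delta00 Fls"
| "Delta00 (s \<^bold>= t)"
| "Delta00 (s \<^bold>< t)"
| "Delta00 (t \<^bold>\<in> X)"
| "Delta00 A \<Longrightarrow> Delta00 B \<Longrightarrow> Delta00 (A \<^bold>\<longrightarrow> B)"
| "Delta00 A \<Longrightarrow> Delta00 (AllN (Var 0 \<^bold>< tlift t \<^bold>\<longrightarrow> A))"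

definition Sigma01 :: "fm \<Rightarrow> bool" where
  "Sigma01 A \<longleftrightarrow> (\<exists>B. Delta00 B \<and> A = ExN B)"

definition Pi01 :: "fm \<Rightarrow> bool" where
  "Pi01 A \<longleftrightarrow> (\<exists>B. Delta00 B \<and> A = AllN B)"

text \<open>Arithmetical formulas: no set quantifiers, but set parameters are allowed.\<close>

primrec arithmetical :: "fm \<Rightarrow> bool" where
  "arithmetical Fls \<longleftrightarrow> True"
| "arithmetical (s \<^bold>= t) \<longleftrightarrow> True"
| "arithmetical (s \<^bold>< t) \<longleftrightarrow> True"
| "arithmetical (t \<^bold>\<in> X) \<longleftrightarrow> True"
| "arithmetical (A \<^bold>\<longrightarrow> B) \<longleftrightarrow> arithmetical A \<and> arithmetical B"
| "arithmetical (AllN A) \<longleftrightarrow> arithmetical A"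
| "arithmetical (AllS A) \<longleftrightarrow> False"

definition Robinson :: "fm set" where
  "Robinson =
    {AllN (\<^bold>\<not> (Succ (Var 0) \<^bold>= Zero)),
     AllN (AllN (Succ (Var 1) \<^bold>= Succ (Var 0) \<^bold>\<longrightarrow> Var 1 \<^bold>= Var 0)),
     AllN (\<^bold>\<not> (Var 0 \<^bold>= Zero) \<^bold>\<longrightarrow> ExN (Var 1 \<^bold>= Succ (Var 0))),
     AllN (Var 0 \<^bold>+ Zero \<^bold>= Var 0),
     AllN (AllN (Var 1 \<^bold>+ Succ (Var 0) \<^bold>= Succ (Var 1 \<^bold>+ Var 0))),
     AllN (Var 0 \<^bold>* Zero \<^bold>= Zero),
     AllN (AllN (Var 1 \<^bold>* Succ (Var 0) \<^bold>= Var 1 \<^bold>* Var 0 \<^bold>+ Var 1)),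
     AllN (AllN (Var 1 \<^bold>< Var 0 \<^bold>\<longleftrightarrow> ExN (Var 2 \<^bold>+ Succ (Var 0) \<^bold>= Var 1)))}"

text \<open>
  In the schemes the distinguished number variable is \<open>Var 0\<close>; all other free variables of \<open>A\<close>
  are parameters.
\<close>

definition induction_ax :: "fm \<Rightarrow> fm" where
  "induction_ax A =
    (instN A Zero
     \<^bold>\<and> AllN (A \<^bold>\<longrightarrow> sub (case_nat (Succ (Var 0)) (\<lambda>n. Var (Suc n))) id A)
     \<^bold>\<longrightarrow> AllN A)"

text \<open>\<open>liftS\<close> ensures that the new set is not a parameter of the defining formula.\<close>

definition comprehension_ax :: "fm \<Rightarrow> fm" where
  "comprehension_ax A = ExS (AllN (Var 0 \<^bold>\<in> 0 \<^bold>\<longleftrightarrow> liftS A))"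

definition RCA0 :: "fm set" where
  "RCA0 = Robinson
    \<union> {induction_ax A | A. Sigma01 A}
    \<union> {AllN (A \<^bold>\<longleftrightarrow> B) \<^bold>\<longrightarrow> comprehension_ax A | A B. Sigma01 A \<and> Pi01 B}"

definition ACA0 :: "fm set" where
  "ACA0 = RCA0 \<union> {comprehension_ax A | A. arithmetical A}"

section \<open>LTL inside second-order arithmetic\<close>

text \<open>
  Relations and functions are sets of codes of ordered pairs, with \<open>(s, t)\<close> coded by
  \<open>(s + t)\<^sup>2 + s\<close>. A triple \<open>(s, t, u)\<close> is \<open>((s, t), u)\<close>.
\<close>

definition pr :: "tm \<Rightarrow> tm \<Rightarrow> tm" where
  "pr s t = (s \<^bold>+ t) \<^bold>* (s \<^bold>+ t) \<^bold>+ s"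

abbreviation mem2 :: "tm \<Rightarrow> tm \<Rightarrow> nat \<Rightarrow> fm" where
  "mem2 s t X \<equiv> pr s t \<^bold>\<in> X"

abbreviation mem3 :: "tm \<Rightarrow> tm \<Rightarrow> tm \<Rightarrow> nat \<Rightarrow> fm" where
  "mem3 s t u X \<equiv> pr (pr s t) u \<^bold>\<in> X"

text \<open>
  Codes of LTL formulas: the k-th propositional variable is \<open>4 k + 1\<close>, and with the Cantor pairing
  bijection \<open>\<langle>s, t\<rangle> = (s + t) (s + t + 1) / 2 + s\<close>,

    \<open>bot = 0\<close>, \<open>s \<rightarrow> t = 4 \<langle>s, t\<rangle> + 2\<close>, \<open>X t = 4 t + 3\<close>, \<open>s U t = 4 \<langle>s, t\<rangle> + 4\<close>.

  The ranges of the five constructors partition the natural numbers, and a formula has a larger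
  code than its immediate subformulas, so every number is the code of exactly one formula: the
  set of all LTL formulas is the set of all numbers, and \<open>is_Fml\<close> holds of every number.
\<close>

definition cantor4 :: "tm \<Rightarrow> tm \<Rightarrow> tm" where
  "cantor4 s t = num 2 \<^bold>* ((s \<^bold>+ t) \<^bold>* (s \<^bold>+ t \<^bold>+ num 1)) \<^bold>+ num 4 \<^bold>* s"

definition c_bot :: tm where
  "c_bot = Zero"

definition c_prop :: "tm \<Rightarrow> tm" where
  "c_prop k = num 4 \<^bold>* k \<^bold>+ num 1"

definition c_imp :: "tm \<Rightarrow> tm \<Rightarrow> tm" where
  "c_imp s t = cantor4 s t \<^bold>+ num 2"

definition c_next :: "tm \<Rightarrow> tm" where
  "c_next t = num 4 \<^bold>* t \<^bold>+ num 3"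

definition c_until :: "tm \<Rightarrow> tm \<Rightarrow> tm" where
  "c_until s t = cantor4 s t \<^bold>+ num 4"

definition is_Fml :: "tm \<Rightarrow> fm" where
  "is_Fml t = (t \<^bold>= t)"

definition is_Prop :: "tm \<Rightarrow> fm" where
  "is_Prop t = ExN (tlift t \<^bold>= c_prop (Var 0))"

text \<open>\<open>E\<close> is an enumeration without repetitions of the set \<open>S\<close>: a bijection from the numbers to \<open>S\<close>.\<close>

definition enumerates :: "nat \<Rightarrow> nat \<Rightarrow> fm" where
  "enumerates E S =
    ( AllN (let z = Var 0 in z \<^bold>\<in> E \<^bold>\<longrightarrow>
        (ExN ^^ 2) (let z = Var 2; i = Var 1; x = Var 0 in x \<^bold>\<in> S \<^bold>\<and> z \<^bold>= pr i x))
    \<^bold>\<and> AllN (ExN (let i = Var 1; x = Var 0 in mem2 i x E))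
    \<^bold>\<and> (AllN ^^ 3) (let i = Var 2; x = Var 1; y = Var 0 in
        mem2 i x E \<^bold>\<and> mem2 i y E \<^bold>\<longrightarrow> x \<^bold>= y)
    \<^bold>\<and> (AllN ^^ 3) (let i = Var 2; j = Var 1; x = Var 0 in
        mem2 i x E \<^bold>\<and> mem2 j x E \<^bold>\<longrightarrow> i \<^bold>= j)
    \<^bold>\<and> AllN (let x = Var 0 in x \<^bold>\<in> S \<^bold>\<longrightarrow>
        ExN (let x = Var 1; i = Var 0 in mem2 i x E)))"

definition LTL_frame :: "nat \<Rightarrow> nat \<Rightarrow> nat \<Rightarrow> fm" where
  "LTL_frame S E R =
    ( enumerates E S
    \<^bold>\<and> AllN (let z = Var 0 in z \<^bold>\<in> R \<^bold>\<longrightarrow>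
        (ExN ^^ 2) (let z = Var 2; x = Var 1; y = Var 0 in
          x \<^bold>\<in> S \<^bold>\<and> y \<^bold>\<in> S \<^bold>\<and> z \<^bold>= pr x y))
    \<^bold>\<and> (AllN ^^ 4) (let i = Var 3; j = Var 2; x = Var 1; y = Var 0 in
        i \<^bold>< j \<^bold>\<and> mem2 i x E \<^bold>\<and> mem2 j y E \<^bold>\<longrightarrow> mem2 x y R))"

text \<open>\<open>V\<close> is a function from \<open>S \<times> D\<close> to \<open>{0, 1}\<close>, where the class \<open>D\<close> of codes is given by a formula.\<close>

definition fun01 :: "nat \<Rightarrow> (tm \<Rightarrow> fm) \<Rightarrow> nat \<Rightarrow> fm" where
  "fun01 S D V =
    ( AllN (let z = Var 0 in z \<^bold>\<in> V \<^bold>\<longrightarrow>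
        (ExN ^^ 3) (let z = Var 3; x = Var 2; p = Var 1; a = Var 0 in
          x \<^bold>\<in> S \<^bold>\<and> D p \<^bold>\<and> a \<^bold>\<le> num 1 \<^bold>\<and> z \<^bold>= pr (pr x p) a))
    \<^bold>\<and> (AllN ^^ 2) (let x = Var 1; p = Var 0 in x \<^bold>\<in> S \<^bold>\<and> D p \<^bold>\<longrightarrow>
        ExN (let x = Var 2; p = Var 1; a = Var 0 in mem3 x p a V))
    \<^bold>\<and> (AllN ^^ 4) (let x = Var 3; p = Var 2; a = Var 1; b = Var 0 in
        mem3 x p a V \<^bold>\<and> mem3 x p b V \<^bold>\<longrightarrow> a \<^bold>= b))"

text \<open>In the clause for implication, \<open>c = 1 - a (1 - b)\<close> is written as \<open>\<exists>d. d + b = 1 \<and> c + a d = 1\<close>.\<close>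

definition LTL_valuation :: "nat \<Rightarrow> nat \<Rightarrow> nat \<Rightarrow> fm" where
  "LTL_valuation S E V =
    ( fun01 S is_Fml V
    \<^bold>\<and> (AllN ^^ 2) (let i = Var 1; x = Var 0 in
        mem2 i x E \<^bold>\<longrightarrow> mem3 x c_bot (num 0) V)
    \<^bold>\<and> (AllN ^^ 7)
        (let i = Var 6; x = Var 5; p = Var 4; q = Var 3; a = Var 2; b = Var 1; c = Var 0 in
        mem2 i x E \<^bold>\<and> mem3 x p a V \<^bold>\<and> mem3 x q b V \<^bold>\<and> mem3 x (c_imp p q) c V \<^bold>\<longrightarrow>
        ExN (let a = Var 3; b = Var 2; c = Var 1; d = Var 0 in
          d \<^bold>+ b \<^bold>= num 1 \<^bold>\<and> c \<^bold>+ a \<^bold>* d \<^bold>= num 1))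
    \<^bold>\<and> (AllN ^^ 4) (let i = Var 3; x = Var 2; y = Var 1; p = Var 0 in
        mem2 i x E \<^bold>\<and> mem2 (i \<^bold>+ num 1) y E \<^bold>\<longrightarrow>
        (mem3 x (c_next p) (num 1) V \<^bold>\<longleftrightarrow> mem3 y p (num 1) V))
    \<^bold>\<and> (AllN ^^ 4) (let i = Var 3; x = Var 2; p = Var 1; q = Var 0 in
        mem2 i x E \<^bold>\<longrightarrow>
        (mem3 x (c_until p q) (num 1) V \<^bold>\<longleftrightarrow>
         ExN (let i = Var 4; p = Var 2; q = Var 1; n = Var 0 in
           i \<^bold>\<le> n
           \<^bold>\<and> (AllN ^^ 2) (let i = Var 6; p = Var 4; n = Var 2; j = Var 1; y = Var 0 in
               i \<^bold>\<le> j \<^bold>\<and> j \<^bold>< n \<^bold>\<and> mem2 j y E \<^bold>\<longrightarrow> mem3 y p (num 1) V)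
           \<^bold>\<and> ExN (let q = Var 2; n = Var 1; y = Var 0 in
               mem2 n y E \<^bold>\<and> mem3 y q (num 1) V)))))"

text \<open>Functions are sets of pairs, so extension is inclusion.\<close>

definition extends :: "nat \<Rightarrow> nat \<Rightarrow> fm" where
  "extends V v = AllN (Var 0 \<^bold>\<in> v \<^bold>\<longrightarrow> Var 0 \<^bold>\<in> V)"

definition Valuation_Extension_LTL :: fm where
  "Valuation_Extension_LTL =
    (AllS ^^ 4) (let S = 3; E = 2; R = 1; v = 0 in
      LTL_frame S E R \<^bold>\<and> fun01 S is_Prop v \<^bold>\<longrightarrow>
      ExS (let S = 4; E = 3; v = 1; V = 0 in
        LTL_valuation S E V \<^bold>\<and> extends V v))"

end

theory Submission
  imports Defs "HOL-Library.Countable_Set"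
begin

text \<open>
  By a Henkin completeness theorem for the calculus it suffices to argue in the models of RCA0.
  Given a set \<open>T\<close> of such a model, take the frame of the numbers with their natural order and the
  assignment making the variable \<open>p k\<close> true in the state \<open>i\<close> iff \<open>(i, k) \<in> T\<close>. A valuation \<open>V\<close>
  extending it decides, at the state 0, the formula \<open>\<top> U p k\<close>, which holds iff \<open>(i, k) \<in> T\<close> for
  some \<open>i\<close>; so the projection of \<open>T\<close> is computable from \<open>V\<close> and hence a set of the model. Closure
  under projections lets every number quantifier be absorbed into a set parameter: each arithmetical
  formula is equivalent to a bounded one with other set parameters, to which comprehension in RCA0
  applies.
\<close>

section \<open>Substitution\<close>

text \<open>Working in models moves the arithmetic out of the calculus: sums, pairs and codes become
  identities between elements of an arbitrary, possibly nonstandard, structure, with induction used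
  only for the sets of that structure. An assumption in HOL cannot quantify over types, so
  completeness is stated for models whose numbers form the type \<open>nat\<close>; their operations
  are unrelated to those of \<open>nat\<close>. The formula \<open>\<top> U p k\<close> is chosen
  because its truth at a single state is an unbounded search through all states: time plays the
  quantified variable, and a valuation, being total on all formulas, has to answer these searches
  for all \<open>k\<close> at once. The code of the formula is a term in \<open>k\<close>, so the
  answers are read off from \<open>V\<close> by an atomic formula. Absorbing a quantifier replaces
  the set parameters of a formula. Therefore the induction on arithmetical formulas speaks about
  predicates of number environments, and the parameters are existentially quantified but independent
  of the environment.\<close>

lemma sub_cong: "\<sigma> = \<sigma>' \<Longrightarrow> \<tau> = \<tau>' \<Longrightarrow> sub \<sigma> \<tau> A = sub \<sigma>' \<tau>' A"
  by simp

lemma tsub_tsub: "tsub \<sigma> (tsub \<rho> t) = tsub (\<lambda>n. tsub \<sigma> (\<rho> n)) t"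
  by (induction t) auto

lemma tsub_Var [simp]: "tsub Var t = t"
  by (induction t) auto

lemma tsub_tlift [simp]: "tsub (case_nat u \<sigma>) (tlift t) = tsub \<sigma> t"
  by (simp add: tlift_def tsub_tsub)

lemma tsub_upN_tlift [simp]: "tsub (upN \<sigma>) (tlift t) = tlift (tsub \<sigma> t)"
  by (simp add: upN_def) (simp add: tlift_def tsub_tsub)

lemma tlift_simps [simp]:
  "tlift (Var n) = Var (Suc n)" "tlift Zero = Zero" "tlift (Succ t) = Succ (tlift t)"
  "tlift (s \<^bold>+ t) = tlift s \<^bold>+ tlift t" "tlift (s \<^bold>* t) = tlift s \<^bold>* tlift t"
  by (simp_all add: tlift_def)

lemma upN_simps [simp]: "upN \<sigma> 0 = Var 0" "upN \<sigma> (Suc n) = tlift (\<sigma> n)"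
  by (simp_all add: upN_def)

lemma upS_simps [simp]: "upS \<tau> 0 = 0" "upS \<tau> (Suc n) = Suc (\<tau> n)"
  by (simp_all add: upS_def)

lemma upN_comp: "(\<lambda>n. tsub (upN \<sigma>) (upN \<rho> n)) = upN (\<lambda>n. tsub \<sigma> (\<rho> n))"
proof
  show "tsub (upN \<sigma>) (upN \<rho> n) = upN (\<lambda>n. tsub \<sigma> (\<rho> n)) n" for n
    by (cases n) auto
qed

lemma upS_comp: "(\<lambda>n. upS \<sigma> (upS \<rho> n)) = upS (\<lambda>n. \<sigma> (\<rho> n))"
proof
  show "upS \<sigma> (upS \<rho> n) = upS (\<lambda>n. \<sigma> (\<rho> n)) n" for n
    by (cases n) auto
qed

lemma sub_sub: "sub \<sigma> \<tau> (sub \<rho> \<kappa> A) = sub (\<lambda>n. tsub \<sigma> (\<rho> n)) (\<lambda>n. \<tau> (\<kappa> n)) A"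
  by (induction A arbitrary: \<sigma> \<tau> \<rho> \<kappa>) (auto simp: tsub_tsub upN_comp upS_comp)

lemma upN_Var [simp]: "upN Var = Var"
  by (auto simp: upN_def fun_eq_iff split: nat.split)

lemma upS_id [simp]: "upS id = id"
  by (auto simp: upS_def fun_eq_iff split: nat.split)

lemma sub_Var_ident [simp]: "sub Var (\<lambda>n. n) A = A"
proof (induction A)
  case (AllS A)
  have "upS (\<lambda>n. n) = (\<lambda>n. n)" using upS_id by (simp add: id_def)
  with AllS show ?case by simp
qed simp_all

lemma sub_Var_id [simp]: "sub Var id A = A"
  by (simp add: id_def)

lemma sub_connectives [simp]:
  "sub \<sigma> \<tau> (\<^bold>\<not> A) = (\<^bold>\<not> sub \<sigma> \<tau> A)"
  "sub \<sigma> \<tau> (A \<^bold>\<and> B) = (sub \<sigma> \<tau> A \<^bold>\<and> sub \<sigma> \<tau> B)"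
  "sub \<sigma> \<tau> (A \<^bold>\<longleftrightarrow> B) = (sub \<sigma> \<tau> A \<^bold>\<longleftrightarrow> sub \<sigma> \<tau> B)"
  "sub \<sigma> \<tau> (ExN A) = ExN (sub (upN \<sigma>) \<tau> A)"
  "sub \<sigma> \<tau> (ExS A) = ExS (sub \<sigma> (upS \<tau>) A)"
  by (simp_all add: Neg_def And_def Iff_def ExN_def ExS_def)

lemma sub_instN: "sub \<sigma> \<tau> (instN A t) = instN (sub (upN \<sigma>) \<tau> A) (tsub \<sigma> t)"
  unfolding instN_def sub_sub by (rule sub_cong) (auto simp: fun_eq_iff split: nat.split)

lemma sub_instS: "sub \<sigma> \<tau> (instS A X) = instS (sub \<sigma> (upS \<tau>) A) (\<tau> X)"
  unfolding instS_def sub_sub by (rule sub_cong) (auto simp: fun_eq_iff split: nat.split)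

lemma sub_upN_liftN: "sub (upN \<sigma>) \<tau> (liftN A) = liftN (sub \<sigma> \<tau> A)"
  unfolding liftN_def sub_sub by (rule sub_cong) (auto simp: fun_eq_iff tlift_def)

lemma sub_upS_liftS: "sub \<sigma> (upS \<tau>) (liftS A) = liftS (sub \<sigma> \<tau> A)"
  unfolding liftS_def sub_sub by (rule sub_cong) (auto simp: fun_eq_iff)

lemma instN_sub_upN: "instN (sub (upN \<sigma>) \<tau> A) t = sub (case_nat t \<sigma>) \<tau> A"
  unfolding instN_def sub_sub by (rule sub_cong) (auto simp: fun_eq_iff split: nat.split)

lemma instS_sub_upS: "instS (sub \<sigma> (upS \<tau>) A) X = sub \<sigma> (case_nat X \<tau>) A"
  unfolding instS_def sub_sub by (rule sub_cong) (auto simp: fun_eq_iff split: nat.split)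

section \<open>Bounds on the free indices of terms and formulas\<close>

definition tsupported :: "nat \<Rightarrow> tm \<Rightarrow> bool" where
  "tsupported k t \<longleftrightarrow> (\<forall>\<sigma> \<sigma>'. (\<forall>n<k. \<sigma> n = \<sigma>' n) \<longrightarrow> tsub \<sigma> t = tsub \<sigma>' t)"

lemma tsupportedI:
  "(\<And>\<sigma> \<sigma>'. (\<And>n. n < k \<Longrightarrow> \<sigma> n = \<sigma>' n) \<Longrightarrow> tsub \<sigma> t = tsub \<sigma>' t) \<Longrightarrow> tsupported k t"
  unfolding tsupported_def by blast

lemma tsupportedD:
  "tsupported k t \<Longrightarrow> (\<And>n. n < k \<Longrightarrow> \<sigma> n = \<sigma>' n) \<Longrightarrow> tsub \<sigma> t = tsub \<sigma>' t"
  unfolding tsupported_def by blast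

lemma tsupported_mono: "tsupported k t \<Longrightarrow> k \<le> l \<Longrightarrow> tsupported l t"
  by (meson tsupportedD tsupportedI less_le_trans)

lemma ex_tsupported_pair:
  assumes "\<exists>k. tsupported k s" "\<exists>k. tsupported k t"
  shows "\<exists>k. tsupported k s \<and> tsupported k t"
  using assms by (meson tsupported_mono max.cobounded1 max.cobounded2)

lemma ex_tsupported: "\<exists>k. tsupported k t"
proof (induction t)
  case (Var n)
  have "tsupported (Suc n) (Var n)" by (rule tsupportedI) simp
  then show ?case ..
next
  case Zero
  have "tsupported 0 Zero" by (rule tsupportedI) simp
  then show ?case ..
next
  case (Succ t)
  then obtain k where "tsupported k t" by blast
  then have "tsupported k (Succ t)"
    by (intro tsupportedI, unfold tsub.simps tm.inject) (rule tsupportedD)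
  then show ?case ..
next
  case (Add s t)
  then obtain k where "tsupported k s" "tsupported k t" using ex_tsupported_pair by blast
  then have "tsupported k (s \<^bold>+ t)"
    by (intro tsupportedI, unfold tsub.simps tm.inject) (intro conjI; rule tsupportedD)
  then show ?case ..
next
  case (Mul s t)
  then obtain k where "tsupported k s" "tsupported k t" using ex_tsupported_pair by blast
  then have "tsupported k (s \<^bold>* t)"
    by (intro tsupportedI, unfold tsub.simps tm.inject) (intro conjI; rule tsupportedD)
  then show ?case ..
qed

text \<open>This replaces a free-variable function: one bound \<open>k\<close> for both sorts of
  indices, expressed by what substitution can see. It suffices for finding fresh variables, and a
  crude bound will do; passing under a quantifier keeps the same \<open>k\<close>.\<close>

definition supported :: "nat \<Rightarrow> fm \<Rightarrow> bool" where
  "supported k A \<longleftrightarrow> (\<forall>\<sigma> \<sigma>' \<tau> \<tau>'. (\<forall>n<k. \<sigma> n = \<sigma>' n \<and> \<tau> n = \<tau>' n) \<longrightarrow> sub \<sigma> \<tau> A = sub \<sigma>' \<tau>' A)"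

lemma supportedD:
  "supported k A \<Longrightarrow> (\<And>n. n < k \<Longrightarrow> \<sigma> n = \<sigma>' n) \<Longrightarrow> (\<And>n. n < k \<Longrightarrow> \<tau> n = \<tau>' n)
    \<Longrightarrow> sub \<sigma> \<tau> A = sub \<sigma>' \<tau>' A"
  unfolding supported_def by blast

lemma supportedI:
  "(\<And>\<sigma> \<sigma>' \<tau> \<tau>'. (\<And>n. n < k \<Longrightarrow> \<sigma> n = \<sigma>' n) \<Longrightarrow> (\<And>n. n < k \<Longrightarrow> \<tau> n = \<tau>' n)
    \<Longrightarrow> sub \<sigma> \<tau> A = sub \<sigma>' \<tau>' A) \<Longrightarrow> supported k A"
  unfolding supported_def by blast

lemma supported_mono: "supported k A \<Longrightarrow> k \<le> l \<Longrightarrow> supported l A"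
  unfolding supported_def by (meson less_le_trans)

lemma ex_supported: "\<exists>k. supported k A"
proof (induction A)
  case (Eq s t)
  obtain k where "tsupported k s" "tsupported k t"
    using ex_tsupported_pair[OF ex_tsupported ex_tsupported] by blast
  then have "supported k (s \<^bold>= t)"
    by (intro supportedI, unfold sub.simps fm.inject) (intro conjI; rule tsupportedD)
  then show ?case ..
next
  case (Less s t)
  obtain k where "tsupported k s" "tsupported k t"
    using ex_tsupported_pair[OF ex_tsupported ex_tsupported] by blast
  then have "supported k (s \<^bold>< t)"
    by (intro supportedI, unfold sub.simps fm.inject) (intro conjI; rule tsupportedD)
  then show ?case ..
next
  case (Mem t X)
  obtain k where "tsupported k t" using ex_tsupported by blast
  then have "tsupported (max k (Suc X)) t" by (rule tsupported_mono) simp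
  then have "supported (max k (Suc X)) (t \<^bold>\<in> X)"
    by (intro supportedI, unfold sub.simps fm.inject)
      (intro conjI, erule tsupportedD, auto simp: less_max_iff_disj)
  then show ?case ..
next
  case (Imp A B)
  then obtain k l where "supported k A" "supported l B" by blast
  then have "supported (max k l) A" "supported (max k l) B" by (auto intro: supported_mono)
  then have "supported (max k l) (A \<^bold>\<longrightarrow> B)"
    by (intro supportedI, unfold sub.simps fm.inject) (intro conjI; rule supportedD)
  then show ?case ..
next
  case (AllN A)
  then obtain k where k: "supported k A" by blast
  have "supported k (AllN A)"
  proof (rule supportedI)
    fix \<sigma> \<sigma>' :: "nat \<Rightarrow> tm" and \<tau> \<tau>' :: "nat \<Rightarrow> nat"
    assume "\<And>n. n < k \<Longrightarrow> \<sigma> n = \<sigma>' n" "\<And>n. n < k \<Longrightarrow> \<tau> n = \<tau>' n"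
    then have "sub (upN \<sigma>) \<tau> A = sub (upN \<sigma>') \<tau>' A"
      by (intro supportedD[OF k]) (auto simp: upN_def split: nat.split)
    then show "sub \<sigma> \<tau> (AllN A) = sub \<sigma>' \<tau>' (AllN A)" by simp
  qed
  then show ?case ..
next
  case (AllS A)
  then obtain k where k: "supported k A" by blast
  have "supported k (AllS A)"
  proof (rule supportedI)
    fix \<sigma> \<sigma>' :: "nat \<Rightarrow> tm" and \<tau> \<tau>' :: "nat \<Rightarrow> nat"
    assume "\<And>n. n < k \<Longrightarrow> \<sigma> n = \<sigma>' n" "\<And>n. n < k \<Longrightarrow> \<tau> n = \<tau>' n"
    then have "sub \<sigma> (upS \<tau>) A = sub \<sigma>' (upS \<tau>') A"
      by (intro supportedD[OF k]) (auto simp: upS_def split: nat.split)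
    then show "sub \<sigma> \<tau> (AllS A) = sub \<sigma>' \<tau>' (AllS A)" by simp
  qed
  then show ?case ..
qed (simp add: supported_def)

lemma ex_supported_list: "\<exists>k. \<forall>A\<in>set \<Gamma>. supported k A"
proof (induction \<Gamma>)
  case (Cons A \<Gamma>)
  then obtain k where k: "\<forall>A\<in>set \<Gamma>. supported k A" by blast
  obtain l where "supported l A" using ex_supported by blast
  with k show ?case
    by (intro exI[of _ "max k l"]) (auto intro: supported_mono)
qed simp

lemma Delta00_sub: "Delta00 A \<Longrightarrow> Delta00 (sub \<sigma> \<tau> A)"
  by (induction A arbitrary: \<sigma> \<tau> rule: Delta00.induct) (auto intro: Delta00.intros)

section \<open>Derivations\<close>

lemma deriv_weaken: "deriv T \<Gamma> A \<Longrightarrow> set \<Gamma> \<subseteq> set \<Delta> \<Longrightarrow> deriv T \<Delta> A"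
proof (induction arbitrary: \<Delta> rule: deriv.induct)
  case (impI A \<Gamma> B)
  then have "deriv T (A # \<Delta>) B" by (auto intro!: impI.IH)
  then show ?case by (rule deriv.impI)
next
  case (impE \<Gamma> A B)
  then show ?case by (blast intro: deriv.impE)
next
  case (raa A \<Gamma>)
  then have "deriv T ((\<^bold>\<not> A) # \<Delta>) Fls" by (auto intro!: raa.IH)
  then show ?case by (rule deriv.raa)
next
  case (allNI \<Gamma> A)
  then have "deriv T (map liftN \<Delta>) A" by (intro allNI.IH) auto
  then show ?case by (rule deriv.allNI)
next
  case (allSI \<Gamma> A)
  then have "deriv T (map liftS \<Delta>) A" by (intro allSI.IH) auto
  then show ?case by (rule deriv.allSI)
next
  case (eqE \<Gamma> s t A)
  then show ?case by (blast intro: deriv.eqE)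
qed (auto intro: deriv.intros)

text \<open>Free variables of an axiom are parameters and the quantifier rules do not lift axioms,
  so renaming variables throughout a derivation requires axioms to become axioms again.\<close>

definition sub_closed :: "fm set \<Rightarrow> bool" where
  "sub_closed T \<longleftrightarrow> (\<forall>A\<in>T. \<forall>\<sigma> \<tau>. sub \<sigma> \<tau> A \<in> T)"

lemma deriv_sub:
  assumes T: "sub_closed T"
  shows "deriv T \<Gamma> A \<Longrightarrow> deriv T (map (sub \<sigma> \<tau>) \<Gamma>) (sub \<sigma> \<tau> A)"
proof (induction arbitrary: \<sigma> \<tau> rule: deriv.induct)
  case (ax A \<Gamma>)
  then show ?case using T by (simp add: sub_closed_def deriv.ax)
next
  case (asm A \<Gamma>)
  then show ?case by (auto intro: deriv.asm)
next
  case (impI A \<Gamma> B)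
  then show ?case by (auto intro: deriv.impI)
next
  case (impE \<Gamma> A B)
  from impE.IH[of \<sigma> \<tau>] show ?case by (auto intro: deriv.impE)
next
  case (raa A \<Gamma>)
  from raa.IH[of \<sigma> \<tau>] show ?case by (auto intro: deriv.raa)
next
  case (allNI \<Gamma> A)
  from allNI.IH[of "upN \<sigma>" \<tau>] show ?case
    by (auto intro!: deriv.allNI simp: sub_upN_liftN comp_def)
next
  case (allNE \<Gamma> A t)
  from allNE.IH[of \<sigma> \<tau>] show ?case by (simp add: sub_instN deriv.allNE)
next
  case (allSI \<Gamma> A)
  from allSI.IH[of \<sigma> "upS \<tau>"] show ?case
    by (auto intro!: deriv.allSI simp: sub_upS_liftS comp_def)
next
  case (allSE \<Gamma> A X)
  from allSE.IH[of \<sigma> \<tau>] show ?case by (simp add: sub_instS deriv.allSE)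
next
  case (eqI \<Gamma> t)
  show ?case by (simp add: deriv.eqI)
next
  case (eqE \<Gamma> s t A)
  from eqE.IH[of \<sigma> \<tau>] show ?case by (auto simp: sub_instN intro: deriv.eqE)
qed

section \<open>Consistent finite lists and Henkin witnesses\<close>

definition consistent :: "fm set \<Rightarrow> fm list \<Rightarrow> bool" where
  "consistent T \<Gamma> \<longleftrightarrow> \<not> deriv T \<Gamma> Fls"

lemma consistent_Neg: "consistent T ((\<^bold>\<not> A) # \<Gamma>) \<longleftrightarrow> \<not> deriv T \<Gamma> A"
proof -
  have "deriv T ((\<^bold>\<not> A) # \<Gamma>) Fls" if "deriv T \<Gamma> A"
  proof (rule deriv.impE)
    show "deriv T ((\<^bold>\<not> A) # \<Gamma>) (A \<^bold>\<longrightarrow> Fls)" by (rule deriv.asm) (simp add: Neg_def)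
    show "deriv T ((\<^bold>\<not> A) # \<Gamma>) A" using that by (rule deriv_weaken) auto
  qed
  then show ?thesis unfolding consistent_def by (blast intro: deriv.raa)
qed

lemma consistent_cases:
  assumes "consistent T \<Gamma>"
  shows "consistent T (A # \<Gamma>) \<or> consistent T ((\<^bold>\<not> A) # \<Gamma>)"
proof (rule disjCI)
  assume "\<not> consistent T ((\<^bold>\<not> A) # \<Gamma>)"
  then have "deriv T \<Gamma> A" by (simp add: consistent_Neg)
  then show "consistent T (A # \<Gamma>)"
    using assms unfolding consistent_def by (blast intro: deriv.impI deriv.impE)
qed

text \<open>A variable that is not free in the assumptions serves as a Henkin constant.\<close>

lemma consistent_witnessN:
  assumes T: "sub_closed T" and con: "consistent T ((\<^bold>\<not> AllN C) # \<Gamma>)"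
  shows "\<exists>t. consistent T ((\<^bold>\<not> instN C t) # (\<^bold>\<not> AllN C) # \<Gamma>)"
proof -
  let ?\<Gamma> = "(\<^bold>\<not> AllN C) # \<Gamma>"
  obtain k where k: "\<forall>A\<in>set (C # ?\<Gamma>). supported k A" using ex_supported_list by blast
  \<comment> \<open>Lifting with one exception: the fresh variable \<open>k\<close> becomes index 0.
    On the assumptions, where \<open>k\<close> does not occur, this is \<open>liftN\<close>; on
    \<open>instN C (Var k)\<close> it gives back \<open>C\<close>. The renamed derivation thus has
    the form that \<open>allNI\<close> expects.\<close>
  let ?\<sigma> = "\<lambda>n. if n = k then Var 0 else Var (Suc n)"
  have "\<not> deriv T ?\<Gamma> (instN C (Var k))"
  proof
    assume "deriv T ?\<Gamma> (instN C (Var k))"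
    then have "deriv T (map (sub ?\<sigma> id) ?\<Gamma>) (sub ?\<sigma> id (instN C (Var k)))"
      by (rule deriv_sub[OF T])
    moreover have "map (sub ?\<sigma> id) ?\<Gamma> = map liftN ?\<Gamma>"
      unfolding liftN_def by (rule map_cong[OF refl], rule supportedD[of k]) (use k in auto)
    moreover have "sub ?\<sigma> id (instN C (Var k)) = sub Var id C"
      unfolding instN_def sub_sub
      by (rule supportedD[of k]) (use k in \<open>auto split: nat.split\<close>)
    ultimately have "deriv T (map liftN ?\<Gamma>) C" by (simp only: sub_Var_id)
    then have "deriv T ?\<Gamma> (AllN C)" by (rule deriv.allNI)
    then have "\<not> consistent T ((\<^bold>\<not> AllN C) # ?\<Gamma>)" by (simp add: consistent_Neg)
    then show False using con unfolding consistent_def by (auto intro: deriv_weaken)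
  qed
  then show ?thesis using consistent_Neg by blast
qed

lemma consistent_witnessS:
  assumes T: "sub_closed T" and con: "consistent T ((\<^bold>\<not> AllS C) # \<Gamma>)"
  shows "\<exists>X. consistent T ((\<^bold>\<not> instS C X) # (\<^bold>\<not> AllS C) # \<Gamma>)"
proof -
  let ?\<Gamma> = "(\<^bold>\<not> AllS C) # \<Gamma>"
  obtain k where k: "\<forall>A\<in>set (C # ?\<Gamma>). supported k A" using ex_supported_list by blast
  let ?\<tau> = "\<lambda>n. if n = k then 0 else Suc n"
  have "\<not> deriv T ?\<Gamma> (instS C k)"
  proof
    assume "deriv T ?\<Gamma> (instS C k)"
    then have "deriv T (map (sub Var ?\<tau>) ?\<Gamma>) (sub Var ?\<tau> (instS C k))"
      by (rule deriv_sub[OF T])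
    moreover have "map (sub Var ?\<tau>) ?\<Gamma> = map liftS ?\<Gamma>"
      unfolding liftS_def by (rule map_cong[OF refl], rule supportedD[of k]) (use k in auto)
    moreover have "sub Var ?\<tau> (instS C k) = sub Var id C"
      unfolding instS_def sub_sub
      by (rule supportedD[of k]) (use k in \<open>auto split: nat.split\<close>)
    ultimately have "deriv T (map liftS ?\<Gamma>) C" by (simp only: sub_Var_id)
    then have "deriv T ?\<Gamma> (AllS C)" by (rule deriv.allSI)
    then have "\<not> consistent T ((\<^bold>\<not> AllS C) # ?\<Gamma>)" by (simp add: consistent_Neg)
    then show False using con unfolding consistent_def by (auto intro: deriv_weaken)
  qed
  then show ?thesis using consistent_Neg by blast
qed

section \<open>Henkin sets and the term model\<close>

locale henkin =
  fixes T H :: "fm set"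
  assumes closed: "deriv T \<Gamma> A \<Longrightarrow> set \<Gamma> \<subseteq> H \<Longrightarrow> A \<in> H"
    and proper: "Fls \<notin> H"
    and complete: "A \<in> H \<or> (\<^bold>\<not> A) \<in> H"
    and witnessN: "(\<^bold>\<not> AllN C) \<in> H \<Longrightarrow> \<exists>t. (\<^bold>\<not> instN C t) \<in> H"
    and witnessS: "(\<^bold>\<not> AllS C) \<in> H \<Longrightarrow> \<exists>X. (\<^bold>\<not> instS C X) \<in> H"

instance tm :: countable by countable_datatype
instance fm :: countable by countable_datatype

text \<open>Lindenbaum construction: stage \<open>n\<close> decides the formula numbered
  \<open>n\<close>, and a rejected universal formula receives its counterexample in the same stage.
  Every stage is a finite list, so some variable is always fresh and the language needs no new
  constants.\<close>

lemma ex_henkin: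
  assumes T: "sub_closed T" and con: "consistent T \<Gamma>"
  shows "\<exists>H. henkin T H \<and> set \<Gamma> \<subseteq> H"
proof -
  define step where "step n \<Delta> \<Delta>' \<longleftrightarrow> set \<Delta> \<subseteq> set \<Delta>' \<and>
    (\<forall>A. to_nat A = n \<longrightarrow> A \<in> set \<Delta>' \<or> (\<^bold>\<not> A) \<in> set \<Delta>' \<and>
      (\<forall>C. A = AllN C \<longrightarrow> (\<exists>t. (\<^bold>\<not> instN C t) \<in> set \<Delta>')) \<and>
      (\<forall>C. A = AllS C \<longrightarrow> (\<exists>X. (\<^bold>\<not> instS C X) \<in> set \<Delta>')))" for n and \<Delta> \<Delta>' :: "fm list"
  have ex: "\<exists>\<Delta>'. consistent T \<Delta>' \<and> step n \<Delta> \<Delta>'" if con: "consistent T \<Delta>" for n \<Delta>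
  proof (cases "\<exists>A::fm. to_nat A = n")
    case True
    then obtain A :: fm where A: "to_nat A = n" by blast
    then have uniq: "to_nat B = n \<longleftrightarrow> B = A" for B using inj_to_nat by (auto simp: inj_on_def)
    consider (pos) "consistent T (A # \<Delta>)" | (neg) "consistent T ((\<^bold>\<not> A) # \<Delta>)"
      using consistent_cases[OF con] by blast
    then show ?thesis
    proof cases
      case pos
      then show ?thesis by (intro exI[of _ "A # \<Delta>"]) (auto simp: step_def uniq)
    next
      case neg
      consider (n) C where "A = AllN C" | (s) C where "A = AllS C" | (other) "\<forall>C. A \<noteq> AllN C \<and> A \<noteq> AllS C"
        by blast
      then show ?thesis
      proof cases
        case n
        then obtain t where "consistent T ((\<^bold>\<not> instN C t) # (\<^bold>\<not> AllN C) # \<Delta>)"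
          using consistent_witnessN[OF T, where C = C and \<Gamma> = \<Delta>] neg by blast
        then show ?thesis using n
          by (intro exI[of _ "(\<^bold>\<not> instN C t) # (\<^bold>\<not> AllN C) # \<Delta>"]) (auto simp: step_def uniq)
      next
        case s
        then obtain X where "consistent T ((\<^bold>\<not> instS C X) # (\<^bold>\<not> AllS C) # \<Delta>)"
          using consistent_witnessS[OF T, where C = C and \<Gamma> = \<Delta>] neg by blast
        then show ?thesis using s
          by (intro exI[of _ "(\<^bold>\<not> instS C X) # (\<^bold>\<not> AllS C) # \<Delta>"]) (auto simp: step_def uniq)
      next
        case other
        then show ?thesis using neg
          by (intro exI[of _ "(\<^bold>\<not> A) # \<Delta>"]) (auto simp: step_def uniq)
      qed
    qed
  next
    case False
    then show ?thesis using con by (auto simp: step_def)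
  qed
  have "\<exists>f. \<forall>n. (consistent T (f n) \<and> (n = 0 \<longrightarrow> f n = \<Gamma>)) \<and> step n (f n) (f (Suc n))"
    by (rule dependent_nat_choice[of "\<lambda>n \<Delta>. consistent T \<Delta> \<and> (n = 0 \<longrightarrow> \<Delta> = \<Gamma>)" step])
      (use con ex in auto)
  then obtain f where "\<forall>n. (consistent T (f n) \<and> (n = 0 \<longrightarrow> f n = \<Gamma>)) \<and> step n (f n) (f (Suc n))" ..
  then have f: "consistent T (f n)" "n = 0 \<Longrightarrow> f n = \<Gamma>" "step n (f n) (f (Suc n))" for n
    by (drule_tac spec[of _ n], elim conjE, simp)+
  define H where "H = (\<Union>n. set (f n))"
  have mono: "m \<le> n \<Longrightarrow> set (f m) \<subseteq> set (f n)" for m n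
    by (rule lift_Suc_mono_le[of "\<lambda>n. set (f n)"]) (use f(3) in \<open>auto simp: step_def\<close>)
  \<comment> \<open>A finite part of the union already lies in one stage; this carries consistency
    to the limit.\<close>
  have fin: "\<exists>n. set \<Delta> \<subseteq> set (f n)" if "set \<Delta> \<subseteq> H" for \<Delta>
    using that
  proof (induction \<Delta>)
    case (Cons A \<Delta>)
    then obtain m n where "set \<Delta> \<subseteq> set (f m)" "A \<in> set (f n)" by (auto simp: H_def)
    then have "set (A # \<Delta>) \<subseteq> set (f (max m n))"
      using mono[of m "max m n"] mono[of n "max m n"] by auto
    then show ?case ..
  qed simp
  have con': "consistent T \<Delta>" if "set \<Delta> \<subseteq> H" for \<Delta>
  proof -
    from fin[OF that] obtain n where "set \<Delta> \<subseteq> set (f n)" ..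
    then show ?thesis using f(1)[of n] deriv_weaken[of T \<Delta> Fls "f n"] unfolding consistent_def by blast
  qed
  have dec: "A \<in> H \<or> (\<^bold>\<not> A) \<in> H \<and>
      (\<forall>C. A = AllN C \<longrightarrow> (\<exists>t. (\<^bold>\<not> instN C t) \<in> H)) \<and>
      (\<forall>C. A = AllS C \<longrightarrow> (\<exists>X. (\<^bold>\<not> instS C X) \<in> H))" for A
  proof -
    note f(3)[of "to_nat A", unfolded step_def, THEN conjunct2, THEN spec, of A, THEN mp, OF refl]
    moreover have "set (f (Suc (to_nat A))) \<subseteq> H" by (auto simp: H_def)
    ultimately show ?thesis by blast
  qed
  have nboth: "\<not> (A \<in> H \<and> (\<^bold>\<not> A) \<in> H)" for A
    using con'[of "[\<^bold>\<not> A, A]"] consistent_Neg[of T A "[A]"] deriv.asm[of A "[A]" T] by auto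
  have "henkin T H"
  proof
    show "A \<in> H" if "deriv T \<Delta> A" "set \<Delta> \<subseteq> H" for \<Delta> A
      using dec[of A] con'[of "(\<^bold>\<not> A) # \<Delta>"] that consistent_Neg by auto
    show "Fls \<notin> H" using con'[of "[Fls]"] deriv.asm[of Fls "[Fls]" T] by (auto simp: consistent_def)
    show "A \<in> H \<or> (\<^bold>\<not> A) \<in> H" for A using dec by blast
    show "\<exists>t. (\<^bold>\<not> instN C t) \<in> H" if "(\<^bold>\<not> AllN C) \<in> H" for C
      using that dec[of "AllN C"] nboth by blast
    show "\<exists>X. (\<^bold>\<not> instS C X) \<in> H" if "(\<^bold>\<not> AllS C) \<in> H" for C
      using that dec[of "AllS C"] nboth by blast
  qed
  moreover have "set \<Gamma> \<subseteq> H" using f(2) by (auto simp: H_def)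
  ultimately show ?thesis by blast
qed

section \<open>Henkin semantics: set quantifiers range over a given family\<close>

locale two_sorted =
  fixes zero :: 'a and suc :: "'a \<Rightarrow> 'a" and add mul :: "'a \<Rightarrow> 'a \<Rightarrow> 'a"
    and less :: "'a \<Rightarrow> 'a \<Rightarrow> bool" and Sets :: "'a set set"
begin

primrec val :: "(nat \<Rightarrow> 'a) \<Rightarrow> tm \<Rightarrow> 'a" where
  "val e (Var n) = e n"
| "val e Zero = zero"
| "val e (Succ t) = suc (val e t)"
| "val e (s \<^bold>+ t) = add (val e s) (val e t)"
| "val e (s \<^bold>* t) = mul (val e s) (val e t)"

primrec sat :: "(nat \<Rightarrow> 'a) \<Rightarrow> (nat \<Rightarrow> 'a set) \<Rightarrow> fm \<Rightarrow> bool" where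
  "sat e s Fls \<longleftrightarrow> False"
| "sat e s (t \<^bold>= u) \<longleftrightarrow> val e t = val e u"
| "sat e s (t \<^bold>< u) \<longleftrightarrow> less (val e t) (val e u)"
| "sat e s (t \<^bold>\<in> X) \<longleftrightarrow> val e t \<in> s X"
| "sat e s (A \<^bold>\<longrightarrow> B) \<longleftrightarrow> (sat e s A \<longrightarrow> sat e s B)"
| "sat e s (AllN A) \<longleftrightarrow> (\<forall>a. sat (case_nat a e) s A)"
| "sat e s (AllS A) \<longleftrightarrow> (\<forall>X\<in>Sets. sat e (case_nat X s) A)"

lemma sat_connectives [simp]:
  "sat e s (\<^bold>\<not> A) \<longleftrightarrow> \<not> sat e s A"
  "sat e s (A \<^bold>\<and> B) \<longleftrightarrow> sat e s A \<and> sat e s B"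
  "sat e s (A \<^bold>\<longleftrightarrow> B) \<longleftrightarrow> (sat e s A \<longleftrightarrow> sat e s B)"
  "sat e s (ExN A) \<longleftrightarrow> (\<exists>a. sat (case_nat a e) s A)"
  "sat e s (ExS A) \<longleftrightarrow> (\<exists>X\<in>Sets. sat e (case_nat X s) A)"
  "sat e s (t \<^bold>\<le> u) \<longleftrightarrow> less (val e t) (suc (val e u))"
  by (auto simp: Neg_def And_def Iff_def ExN_def ExS_def LessEq_def)

lemma val_tsub: "val e (tsub \<sigma> t) = val (\<lambda>n. val e (\<sigma> n)) t"
  by (induction t) auto

lemma val_tlift [simp]: "val (case_nat a e) (tlift t) = val e t"
  by (simp add: tlift_def val_tsub)

lemma val_upN: "(\<lambda>n. val (case_nat a e) (upN \<sigma> n)) = case_nat a (\<lambda>n. val e (\<sigma> n))"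
  by (auto simp: fun_eq_iff upN_def split: nat.split)

lemma upS_env: "(\<lambda>n. case_nat X s (upS \<tau> n)) = case_nat X (\<lambda>n. s (\<tau> n))"
  by (auto simp: fun_eq_iff upS_def split: nat.split)

lemma sat_sub: "sat e s (sub \<sigma> \<tau> A) \<longleftrightarrow> sat (\<lambda>n. val e (\<sigma> n)) (\<lambda>n. s (\<tau> n)) A"
  by (induction A arbitrary: e s \<sigma> \<tau>) (auto simp: val_tsub val_upN upS_env)

lemma sat_liftN [simp]: "sat (case_nat a e) s (liftN A) \<longleftrightarrow> sat e s A"
  by (simp add: liftN_def sat_sub)

lemma sat_liftS [simp]: "sat e (case_nat X s) (liftS A) \<longleftrightarrow> sat e s A"
  by (simp add: liftS_def sat_sub)

lemma sat_instN [simp]: "sat e s (instN A t) \<longleftrightarrow> sat (case_nat (val e t) e) s A"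
proof -
  have "(\<lambda>n. val e (case_nat t Var n)) = case_nat (val e t) e"
    by (auto simp: fun_eq_iff split: nat.split)
  then show ?thesis by (simp add: instN_def sat_sub)
qed

end

section \<open>Membership in a Henkin set behaves like truth\<close>

context henkin
begin

lemma Neg_iff: "(\<^bold>\<not> A) \<in> H \<longleftrightarrow> A \<notin> H"
proof
  assume n: "(\<^bold>\<not> A) \<in> H"
  show "A \<notin> H"
  proof
    assume "A \<in> H"
    have "deriv T [\<^bold>\<not> A, A] Fls"
      by (rule deriv.impE[where A = A]) (auto intro: deriv.asm simp: Neg_def)
    then show False using closed[of "[\<^bold>\<not> A, A]" Fls] n \<open>A \<in> H\<close> proper by auto
  qed
qed (use complete in blast)

lemma Imp_iff: "(A \<^bold>\<longrightarrow> B) \<in> H \<longleftrightarrow> (A \<in> H \<longrightarrow> B \<in> H)"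
proof
  assume i: "(A \<^bold>\<longrightarrow> B) \<in> H"
  have "deriv T [A \<^bold>\<longrightarrow> B, A] B"
    by (rule deriv.impE[where A = A]) (auto intro: deriv.asm)
  then show "A \<in> H \<longrightarrow> B \<in> H" using closed i by auto
next
  assume i: "A \<in> H \<longrightarrow> B \<in> H"
  show "(A \<^bold>\<longrightarrow> B) \<in> H"
  proof (cases "A \<in> H")
    case True
    have "deriv T [B] (A \<^bold>\<longrightarrow> B)" by (simp add: deriv.impI deriv.asm)
    with True i show ?thesis using closed by auto
  next
    case False
    have "deriv T [\<^bold>\<not> A] (A \<^bold>\<longrightarrow> B)"
    proof (rule deriv.impI, rule deriv.raa, rule deriv.impE[where A = A])
      show "deriv T [\<^bold>\<not> B, A, \<^bold>\<not> A] (A \<^bold>\<longrightarrow> Fls)" by (rule deriv.asm) (simp add: Neg_def)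
    qed (auto intro: deriv.asm)
    with False show ?thesis using closed[of "[\<^bold>\<not> A]"] Neg_iff by simp
  qed
qed

lemma AllN_iff: "AllN A \<in> H \<longleftrightarrow> (\<forall>t. instN A t \<in> H)"
proof
  assume "AllN A \<in> H"
  then show "\<forall>t. instN A t \<in> H"
    using closed[of "[AllN A]"] deriv.allNE[OF deriv.asm, of A "[AllN A]"] by auto
qed (use witnessN Neg_iff in blast)

lemma AllS_iff: "AllS A \<in> H \<longleftrightarrow> (\<forall>X. instS A X \<in> H)"
proof
  assume "AllS A \<in> H"
  then show "\<forall>t. instS A t \<in> H"
    using closed[of "[AllS A]"] deriv.allSE[OF deriv.asm, of A "[AllS A]"] by auto
qed (use witnessS Neg_iff in blast)

lemma eq_refl: "(t \<^bold>= t) \<in> H"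
  using closed[of "[]"] deriv.eqI by auto

lemma eq_replace: "(t \<^bold>= u) \<in> H \<Longrightarrow> instN A t \<in> H \<Longrightarrow> instN A u \<in> H"
  using closed[of "[t \<^bold>= u, instN A t]" "instN A u"]
    deriv.eqE[of T "[t \<^bold>= u, instN A t]" t u A] by (simp add: deriv.asm)

lemma instN_atoms [simp]:
  "instN (t \<^bold>= u) v = (tsub (case_nat v Var) t \<^bold>= tsub (case_nat v Var) u)"
  "instN (t \<^bold>< u) v = (tsub (case_nat v Var) t \<^bold>< tsub (case_nat v Var) u)"
  "instN (t \<^bold>\<in> X) v = (tsub (case_nat v Var) t \<^bold>\<in> X)"
  by (simp_all add: instN_def)

text \<open>Here and in the congruences below, \<open>Var 0\<close> marks the place of replacement,
  and \<open>tlift\<close> protects the remaining terms from the instantiation.\<close>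

lemma eq_sym: "(t \<^bold>= u) \<in> H \<Longrightarrow> (u \<^bold>= t) \<in> H"
  using eq_replace[of t u "Var 0 \<^bold>= tlift t"] eq_refl by simp

lemma eq_trans: "(t \<^bold>= u) \<in> H \<Longrightarrow> (u \<^bold>= v) \<in> H \<Longrightarrow> (t \<^bold>= v) \<in> H"
  using eq_replace[of u v "tlift t \<^bold>= Var 0"] by simp

lemma eq_Succ: "(t \<^bold>= u) \<in> H \<Longrightarrow> (Succ t \<^bold>= Succ u) \<in> H"
  using eq_replace[of t u "Succ (tlift t) \<^bold>= Succ (Var 0)"] eq_refl by simp

lemma eq_Add: "(t \<^bold>= t') \<in> H \<Longrightarrow> (u \<^bold>= u') \<in> H \<Longrightarrow> (t \<^bold>+ u \<^bold>= t' \<^bold>+ u') \<in> H"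
  using eq_replace[of t t' "tlift t \<^bold>+ tlift u \<^bold>= Var 0 \<^bold>+ tlift u"]
    eq_replace[of u u' "tlift t \<^bold>+ tlift u \<^bold>= tlift t' \<^bold>+ Var 0"] eq_refl by simp

lemma eq_Mul: "(t \<^bold>= t') \<in> H \<Longrightarrow> (u \<^bold>= u') \<in> H \<Longrightarrow> (t \<^bold>* u \<^bold>= t' \<^bold>* u') \<in> H"
  using eq_replace[of t t' "tlift t \<^bold>* tlift u \<^bold>= Var 0 \<^bold>* tlift u"]
    eq_replace[of u u' "tlift t \<^bold>* tlift u \<^bold>= tlift t' \<^bold>* Var 0"] eq_refl by simp

lemma eq_Less: "(t \<^bold>= t') \<in> H \<Longrightarrow> (u \<^bold>= u') \<in> H \<Longrightarrow> (t \<^bold>< u) \<in> H \<Longrightarrow> (t' \<^bold>< u') \<in> H"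
  using eq_replace[of t t' "Var 0 \<^bold>< tlift u"] eq_replace[of u u' "tlift t' \<^bold>< Var 0"] by simp

lemma eq_Mem: "(t \<^bold>= t') \<in> H \<Longrightarrow> (t \<^bold>\<in> X) \<in> H \<Longrightarrow> (t' \<^bold>\<in> X) \<in> H"
  using eq_replace[of t t' "Var 0 \<^bold>\<in> X"] by simp

lemma ax_in: "A \<in> T \<Longrightarrow> A \<in> H"
  using closed[of "[]"] deriv.ax by auto

lemma num_eq_in:
  assumes "Robinson \<subseteq> T" "(num m \<^bold>= num n) \<in> H"
  shows "m = n"
proof -
  have "AllN (\<^bold>\<not> (Succ (Var 0) \<^bold>= Zero)) \<in> H"
    "AllN (AllN (Succ (Var 1) \<^bold>= Succ (Var 0) \<^bold>\<longrightarrow> Var 1 \<^bold>= Var 0)) \<in> H"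
    using assms(1) ax_in by (auto simp: Robinson_def)
  then have Z: "(Succ t \<^bold>= Zero) \<notin> H" and S: "(Succ t \<^bold>= Succ u) \<in> H \<Longrightarrow> (t \<^bold>= u) \<in> H" for t u
    by (auto simp: AllN_iff instN_def Neg_iff Imp_iff upN_def)
  show ?thesis using assms(2)
  proof (induction m arbitrary: n)
    case 0
    then show ?case using Z eq_sym by (cases n) auto
  next
    case (Suc m)
    then show ?case using Z S by (cases n) auto
  qed
qed

text \<open>
  The numerals are pairwise distinct, so the quotient of the terms by provable equality is countably
  infinite and the term model can be put on the natural numbers.
\<close>

lemma ex_coding:
  assumes "Robinson \<subseteq> T"
  shows "\<exists>c :: tm \<Rightarrow> nat. surj c \<and> (\<forall>t u. c t = c u \<longleftrightarrow> (t \<^bold>= u) \<in> H)"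
proof -
  define q where "q t = {u. (t \<^bold>= u) \<in> H}" for t
  have q: "q t = q u \<longleftrightarrow> (t \<^bold>= u) \<in> H" for t u
    unfolding q_def using eq_refl eq_sym eq_trans by blast
  have "inj (\<lambda>n. q (num n))"
    using num_eq_in[OF assms] by (auto simp: inj_on_def q)
  then have "infinite (range (\<lambda>n. q (num n)))" by (simp add: finite_image_iff)
  then have inf: "infinite (range q)" by (rule contrapos_nn) (auto intro: finite_subset[rotated])
  have cnt: "countable (range q)" by simp
  from to_nat_on_infinite[OF cnt inf] have bij: "bij_betw (to_nat_on (range q)) (range q) UNIV" .
  show ?thesis
  proof (intro exI[of _ "\<lambda>t. to_nat_on (range q) (q t)"] conjI allI)
    show "surj (\<lambda>t. to_nat_on (range q) (q t))"
      using bij by (auto simp: bij_betw_def image_comp comp_def)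
    show "(to_nat_on (range q) (q t) = to_nat_on (range q) (q u)) = ((t \<^bold>= u) \<in> H)" for t u
      using bij by (auto simp: bij_betw_def inj_on_def q[symmetric])
  qed
qed

end

section \<open>Models of RCA0 and completeness\<close>

locale rca = two_sorted +
  assumes nonempty: "Sets \<noteq> {}"
    and axioms: "A \<in> RCA0 \<Longrightarrow> (\<And>n. s n \<in> Sets) \<Longrightarrow> sat e s A"

text \<open>Numbers are the codes of classes of provably equal terms, and \<open>r\<close> picks a
  term from each class. A set variable denotes the class of terms that \<open>H\<close> puts into
  it; variables with the same extension are identified, which is harmless since the language has no
  equality between sets.\<close>

lemma (in henkin) term_model:
  assumes T: "sub_closed T" and Q: "Robinson \<subseteq> T"
  shows "\<exists>(zero::nat) suc add mul less Sets. Sets \<noteq> {} \<and>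
    (\<forall>A\<in>T. \<forall>e s. (\<forall>n. s n \<in> Sets) \<longrightarrow> two_sorted.sat zero suc add mul less Sets e s A) \<and>
    (\<exists>e s. (\<forall>n. s n \<in> Sets) \<and> (\<forall>A\<in>H. two_sorted.sat zero suc add mul less Sets e s A))"
proof -
  obtain c :: "tm \<Rightarrow> nat" where c: "surj c" "\<And>t u. c t = c u \<longleftrightarrow> (t \<^bold>= u) \<in> H"
    using ex_coding[OF Q] by blast
  define r where "r = inv c"
  have cr [simp]: "c (r a) = a" for a using c(1) by (simp add: r_def surj_f_inv_f)
  have rc: "(r (c t) \<^bold>= t) \<in> H" for t using c(2) cr by blast
  define S where "S X = {c t | t. (t \<^bold>\<in> X) \<in> H}" for X
  interpret M: two_sorted "c Zero" "\<lambda>a. c (Succ (r a))" "\<lambda>a b. c (r a \<^bold>+ r b)" "\<lambda>a b. c (r a \<^bold>* r b)"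
    "\<lambda>a b. (r a \<^bold>< r b) \<in> H" "range S" .
  have all_c: "(\<forall>a. P a) \<longleftrightarrow> (\<forall>t. P (c t))" for P
  proof
    assume "\<forall>t. P (c t)"
    then have "P (c (r a))" for a by blast
    then show "\<forall>a. P a" unfolding cr by blast
  qed simp
  have S: "c u \<in> S Y \<longleftrightarrow> (u \<^bold>\<in> Y) \<in> H" for u Y
  proof
    assume "c u \<in> S Y"
    then obtain t where "c t = c u" "(t \<^bold>\<in> Y) \<in> H" by (auto simp: S_def)
    then show "(u \<^bold>\<in> Y) \<in> H" using eq_Mem[of t u Y] c(2)[of t u] by blast
  qed (auto simp: S_def)
  have val: "M.val (\<lambda>n. c (\<sigma> n)) t = c (tsub \<sigma> t)" for \<sigma> t
    by (induction t) (auto simp: c(2) intro: eq_Succ eq_Add eq_Mul rc)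
  \<comment> \<open>An environment with values \<open>c (\<sigma> n)\<close> and
    \<open>S (\<tau> n)\<close> is a substitution in disguise. Letting \<open>\<sigma>\<close> and
    \<open>\<tau>\<close> vary lets the quantifier cases extend them by a witness.\<close>
  have truth: "M.sat (\<lambda>n. c (\<sigma> n)) (\<lambda>n. S (\<tau> n)) A \<longleftrightarrow> sub \<sigma> \<tau> A \<in> H" for \<sigma> \<tau> A
  proof (induction A arbitrary: \<sigma> \<tau>)
    case Fls
    then show ?case using proper by simp
  next
    case (Eq t u)
    then show ?case by (simp add: val c(2))
  next
    case (Less t u)
    show ?case by (simp add: val) (meson eq_Less rc eq_sym)
  next
    case (Mem t X)
    show ?case by (simp add: val S)
  next
    case (Imp A B)
    then show ?case by (simp add: Imp_iff)
  next
    case (AllN A)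
    have "case_nat (c t) (\<lambda>n. c (\<sigma> n)) = (\<lambda>n. c (case_nat t \<sigma> n))" for t
      by (auto simp: fun_eq_iff split: nat.split)
    then have "M.sat (case_nat (c t) (\<lambda>n. c (\<sigma> n))) (\<lambda>n. S (\<tau> n)) A
        \<longleftrightarrow> instN (sub (upN \<sigma>) \<tau> A) t \<in> H" for t
      using AllN[of "case_nat t \<sigma>" \<tau>] by (simp add: instN_sub_upN)
    moreover have "(\<forall>a. M.sat (case_nat a (\<lambda>n. c (\<sigma> n))) (\<lambda>n. S (\<tau> n)) A) \<longleftrightarrow>
        (\<forall>t. M.sat (case_nat (c t) (\<lambda>n. c (\<sigma> n))) (\<lambda>n. S (\<tau> n)) A)"
      by (rule all_c)
    ultimately show ?case unfolding M.sat.simps sub.simps AllN_iff by blast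
  next
    case (AllS A)
    have "case_nat (S X) (\<lambda>n. S (\<tau> n)) = (\<lambda>n. S (case_nat X \<tau> n))" for X
      by (auto simp: fun_eq_iff split: nat.split)
    then have "M.sat (\<lambda>n. c (\<sigma> n)) (case_nat (S X) (\<lambda>n. S (\<tau> n))) A
        \<longleftrightarrow> instS (sub \<sigma> (upS \<tau>) A) X \<in> H" for X
      using AllS[of \<sigma> "case_nat X \<tau>"] by (simp add: instS_sub_upS)
    then show ?case by (simp add: AllS_iff)
  qed
  have "M.sat e s A" if "A \<in> T" "\<forall>n. s n \<in> range S" for A e s
  proof -
    from that(2) obtain \<tau> where "\<And>n. s n = S (\<tau> n)" unfolding image_iff by metis
    then have s: "s = (\<lambda>n. S (\<tau> n))" by (rule ext)
    \<comment> \<open>Any environment is of the form covered by \<open>truth\<close> once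
      representatives are chosen; the substituted axiom is again an axiom and thus lies in
      \<open>H\<close>.\<close>
    have "sub (\<lambda>n. r (e n)) \<tau> A \<in> H"
      using T that(1) ax_in unfolding sub_closed_def by blast
    then show ?thesis using truth[of "\<lambda>n. r (e n)" \<tau> A] unfolding s cr by blast
  qed
  then have 1: "\<forall>A\<in>T. \<forall>e s. (\<forall>n. s n \<in> range S) \<longrightarrow> M.sat e s A" by blast
  have "M.sat (\<lambda>n. c (Var n)) (\<lambda>n. S (id n)) A" if "A \<in> H" for A
    unfolding truth using that by simp
  then have 2: "\<forall>A\<in>H. M.sat (\<lambda>n. c (Var n)) (\<lambda>n. S (id n)) A" by blast
  show ?thesis
  proof (rule exI, rule exI, rule exI, rule exI, rule exI, rule exI, intro conjI)
    show "range S \<noteq> {}" by simp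
    show "\<forall>A\<in>T. \<forall>e s. (\<forall>n. s n \<in> range S) \<longrightarrow> M.sat e s A" by (fact 1)
    show "\<exists>e s. (\<forall>n. s n \<in> range S) \<and> (\<forall>A\<in>H. M.sat e s A)"
    proof (rule exI, rule exI, rule conjI)
      show "\<forall>n. S (id n) \<in> range S" by simp
      show "\<forall>A\<in>H. M.sat (\<lambda>n. c (Var n)) (\<lambda>n. S (id n)) A" by (fact 2)
    qed
  qed
qed

text \<open>The Robinson axioms are sentences. In the schemes a substitution only affects the
  parameters, and bounded formulas stay bounded, so an instance for \<open>B\<close> turns into the
  instance for \<open>sub (upN \<sigma>) \<tau> B\<close>.\<close>

lemma RCA0_sub: "sub_closed RCA0"
  unfolding sub_closed_def
proof (intro ballI allI)
  fix A \<sigma> \<tau> assume A: "A \<in> RCA0"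
  have Sigma: "Sigma01 (sub \<rho> \<tau> B)" if "Sigma01 B" for B \<rho>
    using that Delta00_sub by (fastforce simp: Sigma01_def)
  have Pi: "Pi01 (sub \<rho> \<tau> B)" if "Pi01 B" for B \<rho>
    using that Delta00_sub by (fastforce simp: Pi01_def)
  have ind: "sub \<sigma> \<tau> (induction_ax B) = induction_ax (sub (upN \<sigma>) \<tau> B)" for B
  proof -
    have "sub (upN \<sigma>) \<tau> (sub (case_nat (Succ (Var 0)) (\<lambda>n. Var (Suc n))) id B) =
        sub (case_nat (Succ (Var 0)) (\<lambda>n. Var (Suc n))) id (sub (upN \<sigma>) \<tau> B)"
      unfolding sub_sub
      by (rule sub_cong) (auto simp: fun_eq_iff tlift_def[symmetric] tlift_def[THEN fun_cong, symmetric] split: nat.split)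
    then show ?thesis by (simp add: induction_ax_def sub_instN)
  qed
  have comp: "sub \<sigma> \<tau> (comprehension_ax B) = comprehension_ax (sub (upN \<sigma>) \<tau> B)" for B
    by (simp add: comprehension_ax_def sub_upS_liftS)
  consider (Q) "A \<in> Robinson" | (I) B where "Sigma01 B" "A = induction_ax B"
    | (C) B C where "Sigma01 B" "Pi01 C" "A = (AllN (B \<^bold>\<longleftrightarrow> C) \<^bold>\<longrightarrow> comprehension_ax B)"
    using A unfolding RCA0_def by blast
  then show "sub \<sigma> \<tau> A \<in> RCA0"
  proof cases
    case Q
    then have "sub \<sigma> \<tau> A = A" by (auto simp: Robinson_def numeral_eq_Suc)
    with Q show ?thesis by (simp add: RCA0_def)
  next
    case I
    then show ?thesis using Sigma ind unfolding RCA0_def by blast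
  next
    case C
    then show ?thesis using Sigma[OF C(1), of "upN \<sigma>"] Pi[OF C(2), of "upN \<sigma>"] unfolding RCA0_def
      by (auto simp: comp)
  qed
qed

lemma rca_completeness:
  assumes "\<And>(zero::nat) suc add mul less Sets e s.
    rca zero suc add mul less Sets \<Longrightarrow> (\<And>n. s n \<in> Sets) \<Longrightarrow>
    two_sorted.sat zero suc add mul less Sets e s A"
  shows "RCA0 \<^bold>\<turnstile> A"
proof (rule ccontr)
  assume "\<not> (RCA0 \<^bold>\<turnstile> A)"
  then have "consistent RCA0 [\<^bold>\<not> A]" by (simp add: provable_def consistent_Neg)
  from ex_henkin[OF RCA0_sub this] obtain H where H: "henkin RCA0 H" "(\<^bold>\<not> A) \<in> H" by auto
  have "Robinson \<subseteq> RCA0" by (auto simp: RCA0_def)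
  from henkin.term_model[OF H(1) RCA0_sub this] obtain zero suc add mul less Sets e s where
    ne: "Sets \<noteq> {}" and M: "\<forall>A\<in>RCA0. \<forall>e s. (\<forall>n. s n \<in> Sets) \<longrightarrow>
      two_sorted.sat zero suc add mul less Sets e s A"
    and s: "\<forall>n. s n \<in> Sets" and sat: "\<forall>A\<in>H. two_sorted.sat (zero::nat) suc add mul less Sets e s A"
    by blast
  interpret rca zero suc add mul less Sets
    by unfold_locales (use ne M in auto)
  from sat H(2) have "\<not> sat e s A" by (metis sat_connectives(1))
  then show False using assms[OF rca_axioms] s by blast
qed

section \<open>Arithmetic in models of RCA0\<close>

text \<open>The dual form is taken because \<open>Delta00\<close> has only the bounded universal
  quantifier as a primitive.\<close>

definition ExB :: "tm \<Rightarrow> fm \<Rightarrow> fm" where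
  "ExB t A = (\<^bold>\<not> AllN (Var 0 \<^bold>< tlift t \<^bold>\<longrightarrow> \<^bold>\<not> A))"

lemma Delta00_derived [intro!]:
  "Delta00 A \<Longrightarrow> Delta00 (\<^bold>\<not> A)"
  "Delta00 A \<Longrightarrow> Delta00 B \<Longrightarrow> Delta00 (A \<^bold>\<and> B)"
  "Delta00 A \<Longrightarrow> Delta00 (ExB t A)"
  by (auto simp: Neg_def And_def ExB_def intro!: Delta00.intros)

declare Delta00.intros [intro!]

context rca
begin

lemma sat_ExB [simp]: "sat e s (ExB t A) \<longleftrightarrow> (\<exists>a. less a (val e t) \<and> sat (case_nat a e) s A)"
  by (auto simp: ExB_def)

text \<open>A vacuous quantifier, made possible by \<open>liftN\<close>, presents the same bounded
  formula both as a Sigma01 and as a Pi01 formula.\<close>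

lemma Delta00_comprehension:
  assumes "Delta00 B" "\<And>n. s n \<in> Sets"
  shows "{x. sat (case_nat x e) s B} \<in> Sets"
proof -
  let ?A = "ExN (liftN B)" and ?C = "AllN (liftN B)"
  have "Delta00 (liftN B)" using assms(1) by (simp add: liftN_def Delta00_sub)
  then have "Sigma01 ?A" "Pi01 ?C" by (auto simp: Sigma01_def Pi01_def)
  then have "(AllN (?A \<^bold>\<longleftrightarrow> ?C) \<^bold>\<longrightarrow> comprehension_ax ?A) \<in> RCA0" unfolding RCA0_def by blast
  from axioms[OF this assms(2)] have "\<exists>X\<in>Sets. \<forall>a. a \<in> X \<longleftrightarrow> sat (case_nat a e) s B"
    by (simp add: comprehension_ax_def)
  then obtain X where "X \<in> Sets" "X = {x. sat (case_nat x e) s B}" by blast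
  then show ?thesis by simp
qed

text \<open>Membership in \<open>X\<close> becomes Sigma01 under a vacuous existential quantifier;
  index 0 is the dummy and index 1 the induction variable.\<close>

lemma set_induct:
  assumes "X \<in> Sets" "zero \<in> X" "\<And>x. x \<in> X \<Longrightarrow> suc x \<in> X"
  shows "x \<in> X"
proof -
  have "Sigma01 (ExN (Var 1 \<^bold>\<in> 0))" by (auto simp: Sigma01_def)
  then have "induction_ax (ExN (Var 1 \<^bold>\<in> 0)) \<in> RCA0" unfolding RCA0_def by blast
  from axioms[OF this, of "\<lambda>_. X"] show ?thesis using assms by (simp add: induction_ax_def)
qed

lemma Delta00_induct:
  assumes "Delta00 B" "\<And>n. s n \<in> Sets" "sat (case_nat zero e) s B"
    and "\<And>x. sat (case_nat x e) s B \<Longrightarrow> sat (case_nat (suc x) e) s B"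
  shows "sat (case_nat x e) s B"
  using set_induct[OF Delta00_comprehension[OF assms(1,2), where e = e], where x = x] assms(3,4) by simp

text \<open>Meant for formulas without set variables, whose truth does not depend on
  \<open>s\<close>. Assuming the steps for all \<open>s\<close> and concluding for some
  \<open>s\<close> avoids naming an assignment at each use.\<close>

lemma pure_induct:
  assumes "Delta00 B" "\<And>s. sat (case_nat zero e) s B"
    and "\<And>x s. sat (case_nat x e) s B \<Longrightarrow> sat (case_nat (suc x) e) s B"
  shows "\<exists>s. sat (case_nat x e) s B"
proof -
  obtain X where "X \<in> Sets" using nonempty by blast
  then show ?thesis using Delta00_induct[OF assms(1), of "\<lambda>_. X"] assms(2,3) by blast
qed

lemma robinson: "A \<in> Robinson \<Longrightarrow> (\<And>s. sat e s A \<Longrightarrow> P) \<Longrightarrow> P"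
  using nonempty axioms[of A "\<lambda>_. SOME X. X \<in> Sets"] by (auto simp: RCA0_def some_in_eq)

section \<open>Semiring and order laws\<close>

lemma suc_neq_zero [simp]: "suc x \<noteq> zero"
  by (rule robinson[of "AllN (\<^bold>\<not> (Succ (Var 0) \<^bold>= Zero))"]) (auto simp: Robinson_def)

lemma zero_neq_suc [simp]: "zero \<noteq> suc x"
  using suc_neq_zero by metis

lemma suc_inj [simp]: "suc x = suc y \<longleftrightarrow> x = y"
  by (rule robinson[of "AllN (AllN (Succ (Var 1) \<^bold>= Succ (Var 0) \<^bold>\<longrightarrow> Var 1 \<^bold>= Var 0))"])
    (auto simp: Robinson_def)

lemma zero_or_suc: "x = zero \<or> (\<exists>y. x = suc y)"
  by (rule robinson[of "AllN (\<^bold>\<not> (Var 0 \<^bold>= Zero) \<^bold>\<longrightarrow> ExN (Var 1 \<^bold>= Succ (Var 0)))"])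
    (auto simp: Robinson_def)

lemma add_zero [simp]: "add x zero = x"
  by (rule robinson[of "AllN (Var 0 \<^bold>+ Zero \<^bold>= Var 0)"]) (auto simp: Robinson_def)

lemma add_suc [simp]: "add x (suc y) = suc (add x y)"
  by (rule robinson[of "AllN (AllN (Var 1 \<^bold>+ Succ (Var 0) \<^bold>= Succ (Var 1 \<^bold>+ Var 0)))"])
    (auto simp: Robinson_def)

lemma mul_zero [simp]: "mul x zero = zero"
  by (rule robinson[of "AllN (Var 0 \<^bold>* Zero \<^bold>= Zero)"]) (auto simp: Robinson_def)

lemma mul_suc [simp]: "mul x (suc y) = add (mul x y) x"
  by (rule robinson[of "AllN (AllN (Var 1 \<^bold>* Succ (Var 0) \<^bold>= Var 1 \<^bold>* Var 0 \<^bold>+ Var 1))"])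
    (auto simp: Robinson_def)

lemma less_iff: "less x y \<longleftrightarrow> (\<exists>z. suc (add x z) = y)"
  by (rule robinson[of
        "AllN (AllN (Var 1 \<^bold>< Var 0 \<^bold>\<longleftrightarrow> ExN (Var 2 \<^bold>+ Succ (Var 0) \<^bold>= Var 1)))"])
    (auto simp: Robinson_def numeral_eq_Suc)

lemma add_zero_left [simp]: "add zero x = x"
  using pure_induct[of "Zero \<^bold>+ Var 0 \<^bold>= Var 0"] by auto

lemma add_suc_left [simp]: "add (suc x) y = suc (add x y)"
  using pure_induct[of "Succ (Var 1) \<^bold>+ Var 0 \<^bold>= Succ (Var 1 \<^bold>+ Var 0)" "\<lambda>_. x" y] by auto

lemma add_commute: "add x y = add y x"
  using pure_induct[of "Var 1 \<^bold>+ Var 0 \<^bold>= Var 0 \<^bold>+ Var 1" "\<lambda>_. x" y] by auto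

lemma add_assoc: "add (add x y) z = add x (add y z)"
  using pure_induct[of "(Var 1 \<^bold>+ Var 2) \<^bold>+ Var 0 \<^bold>= Var 1 \<^bold>+ (Var 2 \<^bold>+ Var 0)"
      "case_nat x (\<lambda>_. y)" z] by (auto simp: numeral_eq_Suc)

lemma add_left_commute: "add x (add y z) = add y (add x z)"
  by (metis add_assoc add_commute)

lemmas add_ac = add_assoc add_commute add_left_commute

lemma mul_zero_left [simp]: "mul zero x = zero"
  using pure_induct[of "Zero \<^bold>* Var 0 \<^bold>= Zero"] by auto

lemma mul_suc_left [simp]: "mul (suc x) y = add (mul x y) y"
  using pure_induct[of "Succ (Var 1) \<^bold>* Var 0 \<^bold>= Var 1 \<^bold>* Var 0 \<^bold>+ Var 0" "\<lambda>_. x" y]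
  by (auto simp: add_ac)

lemma mul_commute: "mul x y = mul y x"
  using pure_induct[of "Var 1 \<^bold>* Var 0 \<^bold>= Var 0 \<^bold>* Var 1" "\<lambda>_. x" y] by auto

lemma mul_add: "mul x (add y z) = add (mul x y) (mul x z)"
  using pure_induct[of "Var 1 \<^bold>* (Var 2 \<^bold>+ Var 0) \<^bold>= Var 1 \<^bold>* Var 2 \<^bold>+ Var 1 \<^bold>* Var 0"
      "case_nat x (\<lambda>_. y)" z] by (auto simp: add_ac numeral_eq_Suc)

lemma add_mul: "mul (add y z) x = add (mul y x) (mul z x)"
  by (metis mul_commute mul_add)

lemma add_left_cancel [simp]: "add z x = add z y \<longleftrightarrow> x = y"
  using pure_induct[of "Var 0 \<^bold>+ Var 1 \<^bold>= Var 0 \<^bold>+ Var 2 \<^bold>\<longrightarrow> Var 1 \<^bold>= Var 2"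
      "case_nat x (\<lambda>_. y)" z] by (auto simp: numeral_eq_Suc)

lemma suc_add_neq [simp]: "suc (add x y) \<noteq> x" "x \<noteq> suc (add x y)"
  using add_left_cancel[of x "suc y" zero] by auto

lemma trichotomy: "less x y \<or> x = y \<or> less y x"
proof -
  \<comment> \<open>The disjunction is written with implications, the connectives of the object
    language; \<open>Var 0\<close> is the induction variable \<open>x\<close> and
    \<open>Var 1\<close> the parameter \<open>y\<close>.\<close>
  let ?B = "\<^bold>\<not> (Var 0 \<^bold>< Var 1) \<^bold>\<longrightarrow> \<^bold>\<not> (Var 0 \<^bold>= Var 1) \<^bold>\<longrightarrow> Var 1 \<^bold>< Var 0"
  have "\<exists>s. sat (case_nat x (\<lambda>_. y)) s ?B"
  proof (rule pure_induct)
    show "sat (case_nat zero (\<lambda>_. y)) s ?B" for s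
      using zero_or_suc[of y] by (auto simp: less_iff)
    fix x s assume "sat (case_nat x (\<lambda>_. y)) s ?B"
    then consider (lt) z where "suc (add x z) = y" | (eq) "x = y" | (gt) z where "suc (add y z) = x"
      by (auto simp: less_iff)
    then show "sat (case_nat (suc x) (\<lambda>_. y)) s ?B"
    proof cases
      case lt
      then show ?thesis using zero_or_suc[of z] by (auto simp: less_iff)
    next
      case eq
      have "suc (add y zero) = suc y" by simp
      with eq show ?thesis by (auto simp: less_iff simp del: add_zero)
    next
      case gt
      then have "suc (add y (suc z)) = suc x" by simp
      then show ?thesis by (auto simp: less_iff simp del: add_suc)
    qed
  qed auto
  then show ?thesis by auto
qed

lemma less_suc_iff: "less x (suc y) \<longleftrightarrow> (\<exists>z. add x z = y)"
  by (simp add: less_iff)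

lemma le_refl [simp]: "less x (suc x)"
  unfolding less_suc_iff by (rule exI[of _ zero]) simp

lemma le_trans: "less x (suc y) \<Longrightarrow> less y (suc z) \<Longrightarrow> less x (suc z)"
  unfolding less_suc_iff by (metis add_assoc)

lemma zero_le [simp]: "less zero (suc x)"
  by (simp add: less_suc_iff)

lemma mul_suc_neq: "mul (suc a) (add x (suc d)) \<noteq> mul (suc a) x"
proof -
  have "mul (suc a) (add x (suc d)) = suc (add (mul (suc a) x) (add (mul (suc a) d) a))"
    by (simp only: mul_add mul_suc add_suc add_assoc)
  then show ?thesis by (metis suc_add_neq(1))
qed

lemma mul_left_cancel: "mul (suc a) x = mul (suc a) y \<Longrightarrow> x = y"
  using trichotomy[of x y] mul_suc_neq unfolding less_iff by (metis add_suc)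

section \<open>Pairing\<close>

definition pair :: "'a \<Rightarrow> 'a \<Rightarrow> 'a" where
  "pair s t = add (mul (add s t) (add s t)) s"

lemma val_pr [simp]: "val e (pr s t) = pair (val e s) (val e t)"
  by (simp add: pr_def pair_def)

text \<open>With \<open>a = s + t\<close> and \<open>c = d + 1\<close>, the second square is
  \<open>a^2 + 2ac + c^2\<close>. It exceeds \<open>a^2 + s\<close> because \<open>ac\<close> is at
  least \<open>a\<close>, hence at least \<open>s\<close>, and \<open>c^2\<close> is positive. So
  pairs with different sums have different codes.\<close>

lemma pair_neq:
  assumes "add s' t' = suc (add (add s t) d)"
  shows "pair s t \<noteq> pair s' t'"
proof
  have square: "mul (add a c) (add a c) = add (mul a a) (add (mul a c) (add (mul c a) (mul c c)))" for a c
    by (simp only: mul_add add_mul add_ac)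
  let ?a = "add s t" and ?c = "suc d"
  assume "pair s t = pair s' t'"
  moreover have "add s' t' = add ?a ?c" using assms by simp
  ultimately have "add (mul ?a ?a) s = add (mul (add ?a ?c) (add ?a ?c)) s'"
    by (simp only: pair_def)
  also have "\<dots> = add (mul ?a ?a) (add (mul ?a ?c) (add (mul ?c ?a) (add (mul ?c ?c) s')))"
    unfolding square by (simp only: add_assoc)
  finally have "s = add (mul ?a ?c) (add (mul ?c ?a) (add (mul ?c ?c) s'))"
    by (simp only: add_left_cancel)
  also have "\<dots> = suc (add s (add t (add (mul ?a d) (add (mul ?c ?a) (add (add (mul ?c d) d) s')))))"
    by (simp only: mul_suc[of _ d] add_suc add_suc_left) (simp only: add_ac)
  finally show False by (metis suc_add_neq)
qed

lemma pair_inj [simp]: "pair s t = pair s' t' \<longleftrightarrow> s = s' \<and> t = t'"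
proof
  assume eq: "pair s t = pair s' t'"
  have "add s t = add s' t'"
    using trichotomy[of "add s t" "add s' t'"] pair_neq eq unfolding less_iff by metis
  with eq show "s = s' \<and> t = t'" by (auto simp: pair_def)
qed simp

text \<open>Components never exceed their pair, so decoding needs only bounded quantifiers and stays
  within \<open>Delta00\<close>.\<close>

lemma fst_le_pair [simp]: "less s (suc (pair s t))"
  unfolding less_suc_iff pair_def using add_commute by blast

lemma snd_le_pair [simp]: "less t (suc (pair s t))"
proof (cases "add s t = zero")
  case True
  then have "t = zero" using zero_or_suc[of t] by auto
  then show ?thesis by simp
next
  case False
  then obtain b where b: "add s t = suc b" using zero_or_suc by blast
  have "pair s t = add (add (mul (add s t) b) (add s t)) s"
    unfolding pair_def by (subst (2) b) simp
  also have "\<dots> = add t (add s (add (mul (add s t) b) s))"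
    by (simp only: add_ac)
  finally show ?thesis unfolding less_suc_iff by metis
qed

section \<open>Jumps from valuations\<close>

text \<open>The code terms are evaluated once and sealed as operations on the model, so that
  simplification does not multiply them out. The arithmetic facts later drawn from them are that
  \<open>cprop\<close> is injective and that \<open>x\<close> is at most
  \<open>cprop x\<close>.\<close>

definition cprop :: "'a \<Rightarrow> 'a" where "cprop x = val (\<lambda>_. x) (c_prop (Var 0))"
definition cnext :: "'a \<Rightarrow> 'a" where "cnext x = val (\<lambda>_. x) (c_next (Var 0))"
definition cimp :: "'a \<Rightarrow> 'a \<Rightarrow> 'a" where
  "cimp x y = val (case_nat x (\<lambda>_. y)) (c_imp (Var 0) (Var 1))"
definition cuntil :: "'a \<Rightarrow> 'a \<Rightarrow> 'a" where
  "cuntil x y = val (case_nat x (\<lambda>_. y)) (c_until (Var 0) (Var 1))"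

lemma val_num [simp]: "val e (num n) = (suc ^^ n) zero"
  by (induction n) auto

lemma val_codes [simp]:
  "val e (c_prop t) = cprop (val e t)" "val e (c_next t) = cnext (val e t)"
  "val e (c_imp t u) = cimp (val e t) (val e u)" "val e (c_until t u) = cuntil (val e t) (val e u)"
  by (simp_all only: cprop_def cnext_def cimp_def cuntil_def c_prop_def c_next_def c_imp_def
      c_until_def cantor4_def val.simps val_num nat.case One_nat_def)

lemma cprop_inj [simp]: "cprop x = cprop y \<longleftrightarrow> x = y"
proof
  assume "cprop x = cprop y"
  then have "mul (suc (suc (suc (suc zero)))) x = mul (suc (suc (suc (suc zero)))) y"
    by (simp add: cprop_def c_prop_def numeral_eq_Suc del: mul_suc_left)
  then show "x = y" by (rule mul_left_cancel)
qed simp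

lemma le_cprop [simp]: "less x (suc (cprop x))"
  unfolding less_suc_iff
  by (rule exI[of _ "suc (add x (add x x))"])
    (simp add: cprop_def c_prop_def numeral_eq_Suc add_assoc)

end

section \<open>The canonical frame and the projection read off from a valuation\<close>

context rca
begin

lemma set_comprehension:
  assumes "Delta00 B" "\<And>n. s n \<in> Sets" "\<And>x. sat (case_nat x e) s B \<longleftrightarrow> P x"
  shows "{x. P x} \<in> Sets"
  using Delta00_comprehension[OF assms(1), of s e] assms(2) by (simp add: assms(3))

lemma UNIV_in_Sets: "UNIV \<in> Sets"
proof -
  obtain X where "X \<in> Sets" using nonempty by blast
  then have "{x. True} \<in> Sets"
    by (intro set_comprehension[of "Zero \<^bold>= Zero" "\<lambda>_. X"]) auto
  then show ?thesis by simp
qed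

lemma identity_in_Sets: "{z. \<exists>i. z = pair i i} \<in> Sets"
  by (rule set_comprehension[of "ExB (Succ (Var 0)) (Var 1 \<^bold>= pr (Var 0) (Var 0))" "\<lambda>_. UNIV"])
    (auto simp: UNIV_in_Sets)

lemma order_in_Sets: "{z. \<exists>i j. less i j \<and> z = pair i j} \<in> Sets"
  by (rule set_comprehension[of "ExB (Succ (Var 0)) (ExB (Succ (Var 1))
        (Var 1 \<^bold>< Var 0 \<^bold>\<and> Var 2 \<^bold>= pr (Var 1) (Var 0)))" "\<lambda>_. UNIV"])
    (auto simp: UNIV_in_Sets numeral_eq_Suc)

definition valuation_of :: "'a set \<Rightarrow> 'a set" where
  "valuation_of T = {z. \<exists>i k a. z = pair (pair i (cprop k)) a \<and>
    (pair i k \<in> T \<longrightarrow> a = suc zero) \<and> (pair i k \<notin> T \<longrightarrow> a = zero)}"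

lemma valuation_of_in_Sets:
  assumes "T \<in> Sets"
  shows "valuation_of T \<in> Sets"
  unfolding valuation_of_def
proof (rule set_comprehension[of "ExB (Succ (Var 0)) (ExB (Succ (Var 1)) (ExB (Succ (Var 2))
    (Var 3 \<^bold>= pr (pr (Var 2) (c_prop (Var 1))) (Var 0) \<^bold>\<and>
     (pr (Var 2) (Var 1) \<^bold>\<in> 0 \<^bold>\<longrightarrow> Var 0 \<^bold>= num 1) \<^bold>\<and>
     (\<^bold>\<not> (pr (Var 2) (Var 1) \<^bold>\<in> 0) \<^bold>\<longrightarrow> Var 0 \<^bold>= num 0))))" "\<lambda>_. T"])
  \<comment> \<open>The state \<open>i\<close> and the index \<open>k\<close> are bounded by the
    code of the triple, \<open>k\<close> by way of \<open>cprop k\<close>, so the three bounded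
    quantifiers lose no witness.\<close>
  have "less i (suc (pair (pair i (cprop k)) a))" "less k (suc (pair (pair i (cprop k)) a))" for i k a
    by (meson fst_le_pair snd_le_pair le_cprop le_trans)+
  then show "sat (case_nat x (\<lambda>_. zero)) (\<lambda>_. T) (ExB (Succ (Var 0)) (ExB (Succ (Var 1)) (ExB (Succ (Var 2))
    (Var 3 \<^bold>= pr (pr (Var 2) (c_prop (Var 1))) (Var 0) \<^bold>\<and>
     (pr (Var 2) (Var 1) \<^bold>\<in> 0 \<^bold>\<longrightarrow> Var 0 \<^bold>= num 1) \<^bold>\<and>
     (\<^bold>\<not> (pr (Var 2) (Var 1) \<^bold>\<in> 0) \<^bold>\<longrightarrow> Var 0 \<^bold>= num 0))))) \<longleftrightarrow>
    (\<exists>i k a. x = pair (pair i (cprop k)) a \<and>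
      (pair i k \<in> T \<longrightarrow> a = suc zero) \<and> (pair i k \<notin> T \<longrightarrow> a = zero))" for x
    by (auto simp: numeral_eq_Suc)
qed (use assms in auto)

text \<open>The environment lists \<open>v\<close>, \<open>R\<close>, \<open>E\<close>,
  \<open>S\<close> at set indices 0 to 3, the reverse of the order in which the four set quantifiers
  bind them. The enumeration is the diagonal, so state number \<open>i\<close> is \<open>i\<close>
  itself.\<close>

lemma sat_canonical_frame:
  "sat e (case_nat v (case_nat {z. \<exists>i j. less i j \<and> z = pair i j} (case_nat {z. \<exists>i. z = pair i i}
    (case_nat UNIV s)))) (LTL_frame 3 2 1)"
  by (auto simp: LTL_frame_def enumerates_def Let_def numeral_eq_Suc)

lemma sat_fun01_valuation_of:
  "sat e (case_nat (valuation_of T) (case_nat R (case_nat E (case_nat UNIV s)))) (fun01 3 is_Prop 0)"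
  by (auto simp: fun01_def is_Prop_def valuation_of_def Let_def numeral_eq_Suc)

lemma sat_Valuation_Extension_LTL:
  assumes "sat e s Valuation_Extension_LTL" "S \<in> Sets" "E \<in> Sets" "R \<in> Sets" "v \<in> Sets"
    and "sat e (case_nat v (case_nat R (case_nat E (case_nat S s)))) (LTL_frame 3 2 1)"
    and "sat e (case_nat v (case_nat R (case_nat E (case_nat S s)))) (fun01 3 is_Prop 0)"
  shows "\<exists>V\<in>Sets. sat e (case_nat V (case_nat v (case_nat R (case_nat E (case_nat S s)))))
    (LTL_valuation 4 3 0 \<^bold>\<and> extends 0 1)"
proof -
  have "\<forall>S\<in>Sets. \<forall>E\<in>Sets. \<forall>R\<in>Sets. \<forall>v\<in>Sets. sat e (case_nat v (case_nat R (case_nat E (case_nat S s))))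
    (LTL_frame 3 2 1 \<^bold>\<and> fun01 3 is_Prop 0 \<^bold>\<longrightarrow> ExS (LTL_valuation 4 3 0 \<^bold>\<and> extends 0 1))"
    using assms(1) unfolding Valuation_Extension_LTL_def by (simp add: Let_def numeral_eq_Suc del: sat_connectives)
  then show ?thesis using assms(2-) by simp
qed

text \<open>With the identity as enumeration, a state is determined by its index and every variable
  constrained by \<open>mem2 i x E\<close> is eliminated, leaving the usual truth clauses over the
  numbers of the model.\<close>

lemma sat_LTL_valuation:
  "sat e (case_nat V (case_nat v (case_nat R (case_nat {z. \<exists>i. z = pair i i} (case_nat UNIV s)))))
      (LTL_valuation 4 3 0) \<longleftrightarrow>
    (\<forall>z. z \<in> V \<longrightarrow> (\<exists>x p a. less a (suc (suc zero)) \<and> z = pair (pair x p) a)) \<and>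
    (\<forall>x p. \<exists>a. pair (pair x p) a \<in> V) \<and>
    (\<forall>x p a b. pair (pair x p) a \<in> V \<and> pair (pair x p) b \<in> V \<longrightarrow> a = b) \<and>
    (\<forall>x. pair (pair x zero) zero \<in> V) \<and>
    (\<forall>x p q a b c. pair (pair x p) a \<in> V \<and> pair (pair x q) b \<in> V \<and> pair (pair x (cimp p q)) c \<in> V
      \<longrightarrow> (\<exists>d. add d b = suc zero \<and> add c (mul a d) = suc zero)) \<and>
    (\<forall>x p. pair (pair x (cnext p)) (suc zero) \<in> V \<longleftrightarrow> pair (pair (suc x) p) (suc zero) \<in> V) \<and>
    (\<forall>x p q. pair (pair x (cuntil p q)) (suc zero) \<in> V \<longleftrightarrow>
      (\<exists>n. less x (suc n) \<and>
        (\<forall>j. less x (suc j) \<and> less j n \<longrightarrow> pair (pair j p) (suc zero) \<in> V) \<and>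
        pair (pair n q) (suc zero) \<in> V))"
  by (simp add: LTL_valuation_def fun01_def is_Fml_def c_bot_def Let_def numeral_eq_Suc)

lemma projection_in_Sets:
  assumes VEL: "sat e s Valuation_Extension_LTL" and T: "T \<in> Sets"
  shows "{k. \<exists>i. pair i k \<in> T} \<in> Sets"
proof -
  \<comment> \<open>The code of \<open>bot\<close> is \<open>zero\<close>, so \<open>?top\<close>
    codes \<open>bot\<close> implies \<open>bot\<close>.\<close>
  let ?top = "cimp zero zero" and ?one = "suc zero"
  obtain V where V: "V \<in> Sets" and
    sat: "sat e (case_nat V (case_nat (valuation_of T) (case_nat {z. \<exists>i j. less i j \<and> z = pair i j}
      (case_nat {z. \<exists>i. z = pair i i} (case_nat UNIV s))))) (LTL_valuation 4 3 0 \<^bold>\<and> extends 0 1)"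
    using sat_Valuation_Extension_LTL[OF VEL UNIV_in_Sets identity_in_Sets order_in_Sets
        valuation_of_in_Sets[OF T] sat_canonical_frame sat_fun01_valuation_of] by (rule bexE)
  note valuation = sat[unfolded sat_connectives sat_LTL_valuation, THEN conjunct1]
  note total = valuation[THEN conjunct2, THEN conjunct1]
  note functional = valuation[THEN conjunct2, THEN conjunct2, THEN conjunct1]
  note bot = valuation[THEN conjunct2, THEN conjunct2, THEN conjunct2, THEN conjunct1]
  note imp = valuation[THEN conjunct2, THEN conjunct2, THEN conjunct2, THEN conjunct2, THEN conjunct1]
  note until = valuation[THEN conjunct2, THEN conjunct2, THEN conjunct2, THEN conjunct2, THEN conjunct2, THEN conjunct2]
  have ext: "z \<in> V" if "z \<in> valuation_of T" for z
    using sat that by (simp add: extends_def)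
  have top: "pair (pair x ?top) ?one \<in> V" for x
  proof -
    obtain c where c: "pair (pair x ?top) c \<in> V" using total by blast
    \<comment> \<open>In the clause for implication both arguments have value 0: the witness
      \<open>d\<close> is then 1, its product with 0 vanishes, and \<open>c\<close> has to be
      1.\<close>
    have "\<exists>d. add d zero = ?one \<and> add c (mul zero d) = ?one"
      using imp[THEN spec, THEN spec, THEN spec, THEN spec, THEN spec, THEN spec, of x zero zero zero zero c]
        bot c by blast
    then have "c = ?one" by simp
    with c show ?thesis by simp
  qed
  \<comment> \<open>Inclusion of \<open>v\<close> in \<open>V\<close> yields only positive
    information. The converse holds because \<open>v\<close> is total on variables: off
    \<open>T\<close> it puts the value 0 into \<open>V\<close>, and \<open>V\<close> is
    single-valued.\<close>
  have atom: "pair (pair i (cprop k)) ?one \<in> V \<longleftrightarrow> pair i k \<in> T" for i k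
  proof
    assume "pair i k \<in> T"
    then show "pair (pair i (cprop k)) ?one \<in> V"
      by (intro ext) (auto simp: valuation_of_def)
  next
    assume one: "pair (pair i (cprop k)) ?one \<in> V"
    show "pair i k \<in> T"
    proof (rule ccontr)
      assume "pair i k \<notin> T"
      then have "pair (pair i (cprop k)) zero \<in> V"
        by (intro ext) (auto simp: valuation_of_def)
      with one have "?one = zero" by (intro functional[THEN spec, THEN spec, THEN spec, THEN spec, THEN mp] conjI)
      then show False by simp
    qed
  qed
  show ?thesis
  \<comment> \<open>At state 0 the condition that the witness be no earlier is trivial, and
    \<open>?top\<close> holds everywhere, so the clause for until reduces to the existence of a
    state satisfying \<open>cprop k\<close>.\<close>
  proof (rule set_comprehension[of "pr (pr Zero (c_until (c_imp Zero Zero) (c_prop (Var 0)))) (num 1) \<^bold>\<in> 0" "\<lambda>_. V"])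
    show "sat (case_nat k (\<lambda>_. zero)) (\<lambda>_. V)
        (pr (pr Zero (c_until (c_imp Zero Zero) (c_prop (Var 0)))) (num 1) \<^bold>\<in> 0) \<longleftrightarrow>
      (\<exists>i. pair i k \<in> T)" for k
      using until[THEN spec, THEN spec, THEN spec, of zero ?top "cprop k"] by (simp add: top atom)
  qed (use V in auto)
qed

section \<open>Absorbing number quantifiers into set parameters\<close>

definition delta :: "((nat \<Rightarrow> 'a) \<Rightarrow> bool) \<Rightarrow> bool" where
  "delta P \<longleftrightarrow> (\<exists>B s. Delta00 B \<and> (\<forall>n. s n \<in> Sets) \<and> (\<forall>e. sat e s B \<longleftrightarrow> P e))"

lemma deltaI:
  "Delta00 B \<Longrightarrow> (\<And>n. s n \<in> Sets) \<Longrightarrow> (\<And>e. sat e s B \<longleftrightarrow> P e) \<Longrightarrow> delta P"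
  by (auto simp: delta_def)

text \<open>Each predicate brings its own sequence of set parameters; the two are merged by placing
  one at the even and the other at the odd indices.\<close>

lemma delta_imp:
  assumes "delta P" "delta Q"
  shows "delta (\<lambda>e. P e \<longrightarrow> Q e)"
proof -
  obtain B s where B: "Delta00 B" "\<forall>n. s n \<in> Sets" "\<forall>e. sat e s B \<longleftrightarrow> P e"
    using assms(1) by (auto simp: delta_def)
  obtain C t where C: "Delta00 C" "\<forall>n. t n \<in> Sets" "\<forall>e. sat e t C \<longleftrightarrow> Q e"
    using assms(2) by (auto simp: delta_def)
  show ?thesis
    by (rule deltaI[of "sub Var (\<lambda>n. 2 * n) B \<^bold>\<longrightarrow> sub Var (\<lambda>n. Suc (2 * n)) C"
          "\<lambda>n. if even n then s (n div 2) else t (n div 2)"])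
      (use B C in \<open>auto simp: sat_sub intro!: Delta00_sub\<close>)
qed

lemma delta_subst:
  assumes "delta P"
  shows "delta (\<lambda>e. P (\<lambda>n. val e (\<sigma> n)))"
proof -
  obtain B s where B: "Delta00 B" "\<forall>n. s n \<in> Sets" "\<forall>e. sat e s B \<longleftrightarrow> P e"
    using assms by (auto simp: delta_def)
  show ?thesis
    by (rule deltaI[of "sub \<sigma> id B" s]) (use B in \<open>auto simp: sat_sub intro!: Delta00_sub\<close>)
qed

definition depends :: "nat \<Rightarrow> ((nat \<Rightarrow> 'a) \<Rightarrow> bool) \<Rightarrow> bool" where
  "depends k P \<longleftrightarrow> (\<forall>e e'. (\<forall>n<k. e n = e' n) \<longrightarrow> P e = P e')"

lemma dependsD: "depends k P \<Longrightarrow> (\<And>n. n < k \<Longrightarrow> e n = e' n) \<Longrightarrow> P e = P e'"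
  unfolding depends_def by blast

lemma dependsI: "(\<And>e e'. (\<And>n. n < k \<Longrightarrow> e n = e' n) \<Longrightarrow> P e = P e') \<Longrightarrow> depends k P"
  unfolding depends_def by blast

lemma depends_mono: "depends k P \<Longrightarrow> k \<le> l \<Longrightarrow> depends l P"
  unfolding depends_def by (meson less_le_trans)

lemma ex_depends:
  assumes "delta P"
  shows "\<exists>k. depends k P"
proof -
  obtain B s where B: "\<forall>e. sat e s B \<longleftrightarrow> P e"
    using assms by (auto simp: delta_def)
  obtain k where k: "supported k B" using ex_supported by blast
  have "depends (Suc k) P"
  proof (rule dependsI)
    fix e e' :: "nat \<Rightarrow> 'a" assume eq: "\<And>n. n < Suc k \<Longrightarrow> e n = e' n"
    \<comment> \<open>Indices from \<open>k\<close> on are not free in \<open>B\<close>, so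
      redirecting them to \<open>Var 0\<close> leaves \<open>B\<close> unchanged. Agreement at index
      0 is then required even if \<open>k\<close> is 0, hence the bound
      \<open>Suc k\<close>.\<close>
    let ?\<sigma> = "\<lambda>n. if n < k then Var n else Var 0"
    have sub: "sub ?\<sigma> id B = B"
      using supportedD[OF k, of ?\<sigma> Var id id] by simp
    have "sat e s B \<longleftrightarrow> sat (\<lambda>n. val e (?\<sigma> n)) s B" for e
      using sat_sub[of e s ?\<sigma> id B] by (simp add: sub)
    moreover have "(\<lambda>n. val e (?\<sigma> n)) = (\<lambda>n. val e' (?\<sigma> n))" using eq by auto
    ultimately show "P e = P e'" using B by metis
  qed
  then show ?thesis ..
qed

text \<open>
  A universal quantifier in front of a predicate with parameters \<open>e 0, e 1, ...\<close> is reduced, by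
  pairing off the first two parameters, to the case of one parameter, where the projection of a
  set gives the required set parameter.
\<close>

lemma delta_all_depends:
  assumes proj: "\<And>T. T \<in> Sets \<Longrightarrow> {k. \<exists>i. pair i k \<in> T} \<in> Sets"
    and "delta P" "depends (Suc (Suc k)) P"
  shows "delta (\<lambda>e. \<forall>x. P (case_nat x e))"
  using assms(2,3)
proof (induction k arbitrary: P)
  case 0
  obtain B s where B: "Delta00 B" "\<forall>n. s n \<in> Sets" "\<forall>e. sat e s B \<longleftrightarrow> P e"
    using 0(1) by (auto simp: delta_def)
  let ?\<sigma> = "case_nat (Var (Suc 0)) (\<lambda>_. Var 0)"
  have env: "(\<lambda>n. val (case_nat x (case_nat y e)) (?\<sigma> n)) = case_nat y (\<lambda>_. x)" for x y e
    by (auto simp: fun_eq_iff split: nat.split)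
  \<comment> \<open>Pairs of a counterexample \<open>y\<close> and the parameter \<open>x\<close>:
    projecting \<open>y\<close> away leaves the parameters at which the universal statement fails.
    The constant tail is harmless, as \<open>P\<close> looks only at its first two entries.\<close>
  let ?T = "{z. \<exists>y x. z = pair y x \<and> \<not> P (case_nat y (\<lambda>_. x))}"
  have "?T \<in> Sets"
    by (rule set_comprehension[of "ExB (Succ (Var 0)) (ExB (Succ (Var 1))
          (Var 2 \<^bold>= pr (Var 1) (Var 0) \<^bold>\<and> \<^bold>\<not> sub ?\<sigma> id B))" s])
      (use B in \<open>auto simp: sat_sub env numeral_eq_Suc intro!: Delta00_sub\<close>)
  then have Y: "{x. \<exists>y. pair y x \<in> ?T} \<in> Sets" by (rule proj)
  show ?case
  proof (rule deltaI[of "\<^bold>\<not> (Var 0 \<^bold>\<in> 0)" "\<lambda>_. {x. \<exists>y. pair y x \<in> ?T}"])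
    fix e
    have "P (case_nat y (\<lambda>_. e 0)) = P (case_nat y e)" for y
      by (rule dependsD[OF 0(2)]) (auto simp: less_Suc_eq)
    then show "sat e (\<lambda>_. {x. \<exists>y. pair y x \<in> ?T}) (\<^bold>\<not> (Var 0 \<^bold>\<in> 0)) \<longleftrightarrow> (\<forall>x. P (case_nat x e))"
      by simp
  qed (use Y in auto)
next
  case (Suc k)
  obtain B s where B: "Delta00 B" "\<forall>n. s n \<in> Sets" "\<forall>e. sat e s B \<longleftrightarrow> P e"
    using Suc.prems(1) by (auto simp: delta_def)
  define unpair where "unpair x y e = case_nat (e 0) (case_nat x (case_nat y (\<lambda>n. e (Suc (Suc n)))))"
    for x y :: 'a and e :: "nat \<Rightarrow> 'a"
  \<comment> \<open>Entry 0 remains the variable to be quantified, and entry 1 now carries the code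
    of the first two parameters of \<open>P\<close>, so \<open>P'\<close> has one parameter
    fewer.\<close>
  define P' where "P' e \<longleftrightarrow> (\<exists>x y. e 1 = pair x y \<and> P (unpair x y e))" for e
  let ?\<sigma> = "case_nat (Var (Suc (Suc 0))) (case_nat (Var (Suc 0))
    (case_nat (Var 0) (\<lambda>n. Var (Suc (Suc (Suc (Suc n)))))))"
  have env: "(\<lambda>n. val (case_nat y (case_nat x e)) (?\<sigma> n)) = unpair x y e" for x y e
    by (auto simp: fun_eq_iff unpair_def numeral_eq_Suc split: nat.split)
  have "delta P'" unfolding P'_def
    by (rule deltaI[of "ExB (Succ (Var 1)) (ExB (Succ (Var 2))
          (Var 3 \<^bold>= pr (Var 1) (Var 0) \<^bold>\<and> sub ?\<sigma> id B))" s])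
      (use B in \<open>auto simp: sat_sub env numeral_eq_Suc intro!: Delta00_sub\<close>)
  moreover have "depends (Suc (Suc k)) P'"
  proof (rule dependsI)
    fix e e' :: "nat \<Rightarrow> 'a" assume eq: "\<And>n. n < Suc (Suc k) \<Longrightarrow> e n = e' n"
    have "P (unpair x y e) = P (unpair x y e')" for x y
      by (rule dependsD[OF Suc.prems(2)]) (use eq in \<open>auto simp: unpair_def split: nat.split\<close>)
    moreover have "e 1 = e' 1" using eq by auto
    ultimately show "P' e = P' e'" by (simp add: P'_def)
  qed
  ultimately have "delta (\<lambda>e. \<forall>x. P' (case_nat x e))" by (rule Suc.IH)
  \<comment> \<open>Feeding the pair of the actual first two parameters into the coded position
    undoes the packing; injectivity of \<open>pair\<close> makes the decoding in \<open>P'\<close>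
    return exactly them.\<close>
  from delta_subst[OF this, of "case_nat (pr (Var 0) (Var 1)) (\<lambda>n. Var (Suc (Suc n)))"]
  have "delta (\<lambda>e. \<forall>x. P' (case_nat x (\<lambda>n. val e (case_nat (pr (Var 0) (Var 1)) (\<lambda>n. Var (Suc (Suc n))) n))))" .
  moreover have "P' (case_nat x (\<lambda>n. val e (case_nat (pr (Var 0) (Var 1)) (\<lambda>n. Var (Suc (Suc n))) n)))
      \<longleftrightarrow> P (case_nat x e)" for x e
  proof -
    have "case_nat x (case_nat (e 0) (case_nat (e (Suc 0)) (\<lambda>n. e (Suc (Suc n))))) = case_nat x e"
      by (auto simp: fun_eq_iff split: nat.split)
    then show ?thesis by (simp add: P'_def unpair_def)
  qed
  ultimately show ?case by simp
qed

lemma delta_all: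
  assumes "\<And>T. T \<in> Sets \<Longrightarrow> {k. \<exists>i. pair i k \<in> T} \<in> Sets" "delta P"
  shows "delta (\<lambda>e. \<forall>x. P (case_nat x e))"
proof -
  obtain k where "depends k P" using ex_depends[OF assms(2)] ..
  then have "depends (Suc (Suc k)) P" by (rule depends_mono) simp
  with assms show ?thesis by (rule delta_all_depends)
qed

lemma delta_arithmetical:
  assumes "\<And>T. T \<in> Sets \<Longrightarrow> {k. \<exists>i. pair i k \<in> T} \<in> Sets" "arithmetical A" "\<forall>n. s n \<in> Sets"
  shows "delta (\<lambda>e. sat e s A)"
  using assms(2)
proof (induction A)
  case (Imp A B)
  then show ?case by (simp add: delta_imp)
next
  case (AllN A)
  then show ?case using delta_all[OF assms(1)] by simp
next
  case Fls
  show ?case by (rule deltaI[of Fls s]) (use assms(3) in auto)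
next
  case (Eq t u)
  show ?case by (rule deltaI[of "t \<^bold>= u" s]) (use assms(3) in auto)
next
  case (Less t u)
  show ?case by (rule deltaI[of "t \<^bold>< u" s]) (use assms(3) in auto)
next
  case (Mem t X)
  show ?case by (rule deltaI[of "t \<^bold>\<in> X" s]) (use assms(3) in auto)
qed simp

lemma arithmetical_comprehension:
  assumes "\<And>T. T \<in> Sets \<Longrightarrow> {k. \<exists>i. pair i k \<in> T} \<in> Sets" "arithmetical A" "\<forall>n. s n \<in> Sets"
  shows "sat e s (comprehension_ax A)"
proof -
  obtain B t where "Delta00 B" "\<forall>n. t n \<in> Sets" "\<forall>e. sat e t B \<longleftrightarrow> sat e s A"
    using delta_arithmetical[OF assms] by (auto simp: delta_def)
  then have "{x. sat (case_nat x e) s A} \<in> Sets"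
    by (intro set_comprehension[of B t e]) blast+
  then show ?thesis
    by (auto simp: comprehension_ax_def intro: bexI[of _ "{x. sat (case_nat x e) s A}"])
qed

end

theorem corollary3p19:
  shows "\<forall>A\<in>ACA0. RCA0 \<^bold>\<turnstile> (Valuation_Extension_LTL \<^bold>\<longrightarrow> A)"
proof
  fix A assume "A \<in> ACA0"
  show "RCA0 \<^bold>\<turnstile> (Valuation_Extension_LTL \<^bold>\<longrightarrow> A)"
  proof (rule rca_completeness)
    fix zero :: nat and suc add mul less Sets e and s :: "nat \<Rightarrow> nat set"
    assume "rca zero suc add mul less Sets" and s: "\<And>n. s n \<in> Sets"
    then interpret rca zero suc add mul less Sets by blast
    have "sat e s A" if VEL: "sat e s Valuation_Extension_LTL"
    proof (cases "A \<in> RCA0")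
      case True
      then show ?thesis using s by (rule axioms)
    next
      case False
      with \<open>A \<in> ACA0\<close> obtain B where "A = comprehension_ax B" "arithmetical B"
        unfolding ACA0_def by blast
      then show ?thesis using arithmetical_comprehension[OF projection_in_Sets[OF VEL]] s by blast
    qed
    then show "sat e s (Valuation_Extension_LTL \<^bold>\<longrightarrow> A)" by simp
  qed
qed

end
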